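(* Every regular loxodromic pair $(A,B)$ is simultaneously conjugate in $\mathrm{SL}(2,\mathbb H)$ to a pair $(A_0,B_0)$ of the form $$A_0=\begin{pmatrix} re^{I\theta}&0\\0&r^{-1}e^{J\varphi}\end{pmatrix},\qquad B_0=P\begin{pmatrix} se^{K\theta'}&0\\0&s^{-1}e^{L\varphi'}\end{pmatrix}P^{-1},\qquad P=\frac{1}{\sqrt{|1-w|}}\begin{pmatrix}1&w\\1&1\end{pmatrix},$$ with $r,s>1$, $\theta,\varphi,\theta',\varphi'\in(0,\pi)$, $I,J,K,L\in\mathbb S^2$ and $w\in(\mathbb R+\mathbb R i)\setminus\{0,1\}$ with $\mathrm{Im}(w)\ge0$. The data $(r,\theta,\varphi,s,\theta',\varphi',w)$ are uniquely determined by the simultaneous conjugacy class of $(A,B)$, and $(I,J,K,L)$ is determined exactly up to simultaneous conjugation $(I,J,K,L)\mapsto(qIq^{-1},qJq^{-1},qKq^{-1},qLq^{-1})$ with $q\in \mathrm Z_{\mathbb H^*}(w)\cap\mathbb S^3$, a group which is a circle when $w\notin\mathbb R$. In this normal form the cross ratio of the four fixed points equals $w$, i.e. $\mathbb X(A_0,B_0)=w$.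
   Context: $\mathbb H$ denotes the quaternions with standard units $i,j,k$ and norm $|\cdot|$; $\mathbb H^*=\mathbb H\setminus\{0\}$; $\mathbb S^3=\{q\in\mathbb H:|q|=1\}$; $\mathbb S^2=\{I\in\mathbb H: I^2=-1\}$; $e^{I\theta}=\cos\theta+I\sin\theta$ for $I\in\mathbb S^2$. For $w=x+yi$ with $x,y\in\mathbb R$, $\mathrm{Im}(w)\geq 0$ means $y\ge0$. $\mathrm Z_{\mathbb H^*}(w)$ is the centralizer of $w$ in $\mathbb H^*$. The Dieudonné determinant of $\left(\begin{smallmatrix}a&b\\c&d\end{smallmatrix}\right)\in\mathrm{GL}(2,\mathbb H)$ is $|ad-aca^{-1}b|$ if $a\neq0$ and $|cb|$ if $a=0$; $\mathrm{SL}(2,\mathbb H)$ is the group of matrices of Dieudonné determinant $1$. It acts on $\widehat{\mathbb H}=\mathbb H\cup\{\infty\}$ by $z\mapsto(az+b)(cz+d)^{-1}$. $A\in\mathrm{SL}(2,\mathbb H)$ is loxodromic if it has exactly two fixed points in $\widehat{\mathbb H}$, one attracting ($a_A$) and one repelling ($r_A$); equivalently, $A$ is conjugate in $\mathrm{SL}(2,\mathbb H)$ to $\mathrm{diag}(re^{I\theta},r^{-1}e^{J\varphi})$ with $r>1$, $\theta,\varphi\in[0,\pi]$, $I,J\in\mathbb S^2$. It is regular loxodromic if moreover $\theta,\varphi\in(0,\pi)$. A regular loxodromic pair is a pair $(A,B)$ of regular loxodromic elements of $\mathrm{SL}(2,\mathbb H)$ whose fixed point sets in $\widehat{\mathbb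 H}$ are disjoint. Simultaneous conjugation is $(A,B)\mapsto(gAg^{-1},gBg^{-1})$, $g\in\mathrm{SL}(2,\mathbb H)$. The cross ratio of four distinct points is $\mathbb X(z_1,z_2,z_3,z_4)=(z_1-z_3)(z_2-z_3)^{-1}(z_2-z_4)(z_1-z_4)^{-1}$, with the convention $\mathbb X(\infty,z_2,z_3,z_4)=(z_2-z_3)^{-1}(z_2-z_4)$ (and, in general, it is well defined up to similarity under Möbius transformations). The cross ratio of a loxodromic pair is $\mathbb X(A,B)=\mathbb X(a_A,r_A,a_B,r_B)$. *)

theory Defs
  imports "HOL-Analysis.Analysis" "HOL-Algebra.Group"
begin


codatatype quat = Quat (qRe: real) (qI: real) (qJ: real) (qK: real)

lemma quat_eqI [intro?]:
  "\<lbrakk>qRe x = qRe y; qI x = qI y; qJ x = qJ y; qK x = qK y\<rbrakk> \<Longrightarrow> x = y"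
  by (rule quat.expand) simp

lemma quat_eq_iff:
  "x = y \<longleftrightarrow> qRe x = qRe y \<and> qI x = qI y \<and> qJ x = qJ y \<and> qK x = qK y"
  by (auto intro: quat.expand)

instantiation quat :: ab_group_add
begin

primcorec zero_quat where
  "qRe 0 = 0" | "qI 0 = 0" | "qJ 0 = 0" | "qK 0 = 0"

primcorec plus_quat where
  "qRe (x + y) = qRe x + qRe y"
| "qI (x + y) = qI x + qI y"
| "qJ (x + y) = qJ x + qJ y"
| "qK (x + y) = qK x + qK y"

primcorec uminus_quat where
  "qRe (- x) = - qRe x" | "qI (- x) = - qI x" | "qJ (- x) = - qJ x" | "qK (- x) = - qK x"

primcorec minus_quat where
  "qRe (x - y) = qRe x - qRe y"
| "qI (x - y) = qI x - qI y"
| "qJ (x - y) = qJ x - qJ y"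
| "qK (x - y) = qK x - qK y"

instance
  by standard (simp_all add: quat_eq_iff)

end

instantiation quat :: ring_1
begin

primcorec one_quat where
  "qRe 1 = 1" | "qI 1 = 0" | "qJ 1 = 0" | "qK 1 = 0"

primcorec times_quat where
  "qRe (x * y) = qRe x * qRe y - qI x * qI y - qJ x * qJ y - qK x * qK y"
| "qI (x * y) = qRe x * qI y + qI x * qRe y + qJ x * qK y - qK x * qJ y"
| "qJ (x * y) = qRe x * qJ y - qI x * qK y + qJ x * qRe y + qK x * qI y"
| "qK (x * y) = qRe x * qK y + qI x * qJ y - qJ x * qI y + qK x * qRe y"

instance
  by standard (simp_all add: quat_eq_iff algebra_simps)

end

instantiation quat :: real_algebra_1
begin

primcorec scaleR_quat where
  "qRe (scaleR r x) = r * qRe x"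
| "qI (scaleR r x) = r * qI x"
| "qJ (scaleR r x) = r * qJ x"
| "qK (scaleR r x) = r * qK x"

instance
  by standard (simp_all add: quat_eq_iff algebra_simps)

end

instantiation quat :: real_inner
begin

definition inner_quat :: "quat \<Rightarrow> quat \<Rightarrow> real" where
  "inner_quat x y = qRe x * qRe y + qI x * qI y + qJ x * qJ y + qK x * qK y"

definition norm_quat :: "quat \<Rightarrow> real" where
  "norm_quat x = sqrt ((qRe x)\<^sup>2 + (qI x)\<^sup>2 + (qJ x)\<^sup>2 + (qK x)\<^sup>2)"

definition sgn_quat :: "quat \<Rightarrow> quat" where
  "sgn_quat x = x /\<^sub>R norm x"

definition dist_quat :: "quat \<Rightarrow> quat \<Rightarrow> real" where
  "dist_quat x y = norm (x - y)"

definition uniformity_quat :: "(quat \<times> quat) filter" where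
  "uniformity_quat = (INF e\<in>{0<..}. principal {(x, y). dist x y < e})"

definition open_quat :: "quat set \<Rightarrow> bool" where
  "open_quat U \<longleftrightarrow> (\<forall>x\<in>U. eventually (\<lambda>(x', y). x' = x \<longrightarrow> y \<in> U) uniformity)"

instance
proof
  fix r :: real and x y z :: quat and S :: "quat set"
  show "dist x y = norm (x - y)"
    by (rule dist_quat_def)
  show "sgn x = x /\<^sub>R norm x"
    by (rule sgn_quat_def)
  show "(uniformity :: (quat \<times> quat) filter)
      = (INF e\<in>{0<..}. principal {(x, y). dist x y < e})"
    by (rule uniformity_quat_def)
  show "open S = (\<forall>x\<in>S. \<forall>\<^sub>F (x', y) in uniformity. x' = x \<longrightarrow> y \<in> S)"
    by (rule open_quat_def)
  show "inner x y = inner y x"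
    by (simp add: inner_quat_def algebra_simps)
  show "inner (x + y) z = inner x z + inner y z"
    by (simp add: inner_quat_def algebra_simps)
  show "inner (r *\<^sub>R x) y = r * inner x y"
    by (simp add: inner_quat_def algebra_simps)
  show "0 \<le> inner x x"
    by (simp add: inner_quat_def)
  have "a * a + b * b + c * c + d * d = 0 \<longleftrightarrow> a = 0 \<and> b = 0 \<and> c = 0 \<and> d = 0"
    for a b c d :: real
    by (simp add: add_nonneg_eq_0_iff)
  then show "inner x x = 0 \<longleftrightarrow> x = 0"
    by (simp add: inner_quat_def quat_eq_iff)
  show "norm x = sqrt (inner x x)"
    by (simp add: norm_quat_def inner_quat_def power2_eq_square)
qed

end

instantiation quat :: real_normed_div_algebra
begin

primcorec inverse_quat where
  "qRe (inverse x) = qRe x / ((qRe x)\<^sup>2 + (qI x)\<^sup>2 + (qJ x)\<^sup>2 + (qK x)\<^sup>2)"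
| "qI (inverse x) = - qI x / ((qRe x)\<^sup>2 + (qI x)\<^sup>2 + (qJ x)\<^sup>2 + (qK x)\<^sup>2)"
| "qJ (inverse x) = - qJ x / ((qRe x)\<^sup>2 + (qI x)\<^sup>2 + (qJ x)\<^sup>2 + (qK x)\<^sup>2)"
| "qK (inverse x) = - qK x / ((qRe x)\<^sup>2 + (qI x)\<^sup>2 + (qJ x)\<^sup>2 + (qK x)\<^sup>2)"

definition divide_quat :: "quat \<Rightarrow> quat \<Rightarrow> quat" where
  "divide_quat x y = x * inverse y"

instance
proof
  fix x y :: quat
  show "x div y = x * inverse y"
    by (rule divide_quat_def)
  show "inverse 0 = (0 :: quat)"
    by (simp add: quat_eq_iff)
  show "norm (x * y) = norm x * norm y"
    unfolding norm_quat_def real_sqrt_mult[symmetric] times_quat.sel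
    by (rule arg_cong[where f = sqrt]) (simp add: power2_eq_square algebra_simps)
  assume "x \<noteq> 0"
  define N where "N = (qRe x)\<^sup>2 + (qI x)\<^sup>2 + (qJ x)\<^sup>2 + (qK x)\<^sup>2"
  have "inner x x \<noteq> 0"
    using \<open>x \<noteq> 0\<close> by simp
  then have "N \<noteq> 0"
    by (simp add: N_def inner_quat_def power2_eq_square)
  have "qRe x / N * qRe x + qI x / N * qI x + qJ x / N * qJ x + qK x / N * qK x = N / N"
    unfolding times_divide_eq_left add_divide_distrib[symmetric]
    by (simp add: N_def power2_eq_square)
  then have *: "qRe x / N * qRe x + qI x / N * qI x + qJ x / N * qJ x + qK x / N * qK x = 1"
    using \<open>N \<noteq> 0\<close> by simp
  show "inverse x * x = 1" "x * inverse x = 1"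
    using * unfolding quat_eq_iff times_quat.sel inverse_quat.sel one_quat.sel N_def[symmetric]
    by (simp_all add: mult.commute)
qed

end

instantiation quat :: euclidean_space
begin

definition Basis_quat :: "quat set" where
  "Basis_quat = {Quat 1 0 0 0, Quat 0 1 0 0, Quat 0 0 1 0, Quat 0 0 0 1}"

instance
proof
  fix u v x :: quat
  show "(Basis :: quat set) \<noteq> {}" "finite (Basis :: quat set)"
    by (simp_all add: Basis_quat_def)
  show "u \<in> Basis \<Longrightarrow> v \<in> Basis \<Longrightarrow> inner u v = (if u = v then 1 else 0)"
    unfolding Basis_quat_def by (elim insertE emptyE; simp add: inner_quat_def)
  show "(\<forall>u\<in>Basis. inner x u = 0) \<longleftrightarrow> x = 0"
    unfolding Basis_quat_def ball_simps by (simp add: inner_quat_def) (simp add: quat_eq_iff)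
qed

end

definition quat_i :: quat where "quat_i = Quat 0 1 0 0"
definition quat_j :: quat where "quat_j = Quat 0 0 1 0"
definition quat_k :: quat where "quat_k = Quat 0 0 0 1"

lemma quat_units:
  "quat_i * quat_i = -1" "quat_j * quat_j = -1" "quat_k * quat_k = -1"
  "quat_i * quat_j = quat_k" "quat_j * quat_k = quat_i" "quat_k * quat_i = quat_j"
  "quat_j * quat_i = - quat_k" "quat_k * quat_j = - quat_i" "quat_i * quat_k = - quat_j"
  by (simp_all add: quat_eq_iff quat_i_def quat_j_def quat_k_def)

lemma Quat_eq_units:
  "Quat a b c d = of_real a + of_real b * quat_i + of_real c * quat_j + of_real d * quat_k"
  by (simp add: quat_eq_iff quat_i_def quat_j_def quat_k_def of_real_def)

definition imag_units :: "quat set" where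
  "imag_units = {I. I\<^sup>2 = -1}"

definition qcis :: "quat \<Rightarrow> real \<Rightarrow> quat" where
  "qcis I \<theta> = of_real (cos \<theta>) + I * of_real (sin \<theta>)"

definition closed_upper_half_plane :: "quat set" where
  "closed_upper_half_plane = {of_real x + of_real y * quat_i | x y :: real. 0 \<le> y}"

definition centralizer :: "quat \<Rightarrow> quat set" where
  "centralizer w = {q. q \<noteq> 0 \<and> q * w = w * q}"

definition unit_centralizer :: "quat \<Rightarrow> quat monoid" where
  "unit_centralizer w =
     \<lparr>carrier = centralizer w \<inter> sphere 0 1, monoid.mult = (*), one = 1\<rparr>"

definition circle_group :: "complex monoid" where
  "circle_group = \<lparr>carrier = sphere 0 1, monoid.mult = (*), one = 1\<rparr>"



definition mat2 :: "quat \<Rightarrow> quat \<Rightarrow> quat \<Rightarrow> quat \<Rightarrow> quat^2^2" where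
  "mat2 a b c d = vector [vector [a, b], vector [c, d]]"

definition dieudonne_det :: "quat^2^2 \<Rightarrow> real" where
  "dieudonne_det A =
     (let a = A$1$1; b = A$1$2; c = A$2$1; d = A$2$2
      in if a \<noteq> 0 then norm (a * d - a * c * inverse a * b) else norm (c * b))"

definition SL2H :: "(quat^2^2) set" where
  "SL2H = {A. invertible A \<and> dieudonne_det A = 1}"

text \<open>The extended quaternions are the type \<^typ>\<open>quat option\<close>, with \<^term>\<open>None\<close> as the
  point at infinity, and with the topology of the one-point compactification.\<close>

definition mobius :: "quat^2^2 \<Rightarrow> quat option \<Rightarrow> quat option" where
  "mobius A z =
     (let a = A$1$1; b = A$1$2; c = A$2$1; d = A$2$2
      in case z of
           None \<Rightarrow> if c = 0 then None else Some (a * inverse c)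
         | Some x \<Rightarrow>
             if c * x + d = 0 then None else Some ((a * x + b) * inverse (c * x + d)))"

definition hat_topology :: "quat option topology" where
  "hat_topology = Alexandroff_compactification euclidean"

definition fixed_points :: "quat^2^2 \<Rightarrow> quat option set" where
  "fixed_points A = {z. mobius A z = z}"

text \<open>Attracting means that the iterates converge to the fixed point uniformly on some
  neighbourhood of it; this excludes the fixed point of a parabolic element.\<close>

definition attracting_fixed_point :: "quat^2^2 \<Rightarrow> quat option \<Rightarrow> bool" where
  "attracting_fixed_point A p \<longleftrightarrow>
     p \<in> fixed_points A \<and>
     (\<exists>U. openin hat_topology U \<and> p \<in> U \<and>
       (\<forall>V. openin hat_topology V \<and> p \<in> V \<longrightarrow>
          (\<forall>\<^sub>F n in sequentially. (mobius A ^^ n) ` U \<subseteq> V)))"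

definition repelling_fixed_point :: "quat^2^2 \<Rightarrow> quat option \<Rightarrow> bool" where
  "repelling_fixed_point A p \<longleftrightarrow> attracting_fixed_point (matrix_inv A) p"

definition loxodromic :: "quat^2^2 \<Rightarrow> bool" where
  "loxodromic A \<longleftrightarrow>
     A \<in> SL2H \<and>
     (\<exists>a r. a \<noteq> r \<and> fixed_points A = {a, r} \<and>
        attracting_fixed_point A a \<and> repelling_fixed_point A r)"

definition attractor :: "quat^2^2 \<Rightarrow> quat option" where
  "attractor A = (THE p. attracting_fixed_point A p)"

definition repeller :: "quat^2^2 \<Rightarrow> quat option" where
  "repeller A = (THE p. repelling_fixed_point A p)"

definition loxodromic_diag :: "real \<Rightarrow> real \<Rightarrow> real \<Rightarrow> quat \<Rightarrow> quat \<Rightarrow> quat^2^2" where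
  "loxodromic_diag r \<theta> \<phi> I J =
     mat2 (of_real r * qcis I \<theta>) 0 0 (of_real (inverse r) * qcis J \<phi>)"

definition regular_loxodromic :: "quat^2^2 \<Rightarrow> bool" where
  "regular_loxodromic A \<longleftrightarrow>
     loxodromic A \<and>
     (\<exists>g\<in>SL2H. \<exists>r>1. \<exists>\<theta>\<in>{0<..<pi}. \<exists>\<phi>\<in>{0<..<pi}. \<exists>I\<in>imag_units. \<exists>J\<in>imag_units.
        g ** A ** matrix_inv g = loxodromic_diag r \<theta> \<phi> I J)"

definition regular_loxodromic_pair :: "quat^2^2 \<Rightarrow> quat^2^2 \<Rightarrow> bool" where
  "regular_loxodromic_pair A B \<longleftrightarrow>
     regular_loxodromic A \<and> regular_loxodromic B \<and> fixed_points A \<inter> fixed_points B = {}"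

definition simultaneously_conjugate ::
    "quat^2^2 \<Rightarrow> quat^2^2 \<Rightarrow> quat^2^2 \<Rightarrow> quat^2^2 \<Rightarrow> bool" where
  "simultaneously_conjugate A B A' B' \<longleftrightarrow>
     (\<exists>g\<in>SL2H. A' = g ** A ** matrix_inv g \<and> B' = g ** B ** matrix_inv g)"

text \<open>A point at infinity is handled by omitting the two factors in which it occurs. The
  value is only meant for four distinct points.\<close>

fun cross_ratio ::
    "quat option \<Rightarrow> quat option \<Rightarrow> quat option \<Rightarrow> quat option \<Rightarrow> quat" where
  "cross_ratio (Some z1) (Some z2) (Some z3) (Some z4) =
     (z1 - z3) * inverse (z2 - z3) * (z2 - z4) * inverse (z1 - z4)"
| "cross_ratio None (Some z2) (Some z3) (Some z4) = inverse (z2 - z3) * (z2 - z4)"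
| "cross_ratio (Some z1) None (Some z3) (Some z4) = (z1 - z3) * inverse (z1 - z4)"
| "cross_ratio (Some z1) (Some z2) None (Some z4) = (z2 - z4) * inverse (z1 - z4)"
| "cross_ratio (Some z1) (Some z2) (Some z3) None = (z1 - z3) * inverse (z2 - z3)"
| "cross_ratio _ _ _ _ = 0"

definition cross_ratio_pair :: "quat^2^2 \<Rightarrow> quat^2^2 \<Rightarrow> quat" where
  "cross_ratio_pair A B = cross_ratio (attractor A) (repeller A) (attractor B) (repeller B)"



definition P_mat :: "quat \<Rightarrow> quat^2^2" where
  "P_mat w = (1 / sqrt (norm (1 - w))) *\<^sub>R mat2 1 w 1 1"

definition B_normal :: "real \<Rightarrow> real \<Rightarrow> real \<Rightarrow> quat \<Rightarrow> quat \<Rightarrow> quat \<Rightarrow> quat^2^2" where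
  "B_normal s \<theta>' \<phi>' w K L = P_mat w ** loxodromic_diag s \<theta>' \<phi>' K L ** matrix_inv (P_mat w)"

definition normal_form_of ::
    "quat^2^2 \<Rightarrow> quat^2^2 \<Rightarrow> real \<Rightarrow> real \<Rightarrow> real \<Rightarrow> real \<Rightarrow> real \<Rightarrow> real \<Rightarrow> quat
      \<Rightarrow> quat \<Rightarrow> quat \<Rightarrow> quat \<Rightarrow> quat \<Rightarrow> bool" where
  "normal_form_of A B r \<theta> \<phi> s \<theta>' \<phi>' w I J K L \<longleftrightarrow>
     1 < r \<and> 1 < s \<and>
     {\<theta>, \<phi>, \<theta>', \<phi>'} \<subseteq> {0<..<pi} \<and>
     {I, J, K, L} \<subseteq> imag_units \<and>
     w \<in> closed_upper_half_plane - {0, 1} \<and>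
     simultaneously_conjugate A B (loxodromic_diag r \<theta> \<phi> I J) (B_normal s \<theta>' \<phi>' w K L)"

end

theory Submission
  imports Defs
begin

text \<open>
  The fixed points of \<open>A\<close> and \<open>B\<close> form four distinct points, and the group has just enough
  freedom to put them at \<open>\<infinity>, 0, 1, w\<close>. A matrix fixing \<open>\<infinity>\<close> and \<open>0\<close> is diagonal, say
  \<open>diag(p, q)\<close>, and acts by \<open>z \<mapsto> p z q\<^sup>-\<^sup>1\<close>. Requiring that the attracting point \<open>x\<close> of \<open>B\<close> goes
  to \<open>1\<close> forces \<open>q = p x\<close>, after which the repelling point \<open>y\<close> goes to the conjugate
  \<open>p (y x\<^sup>-\<^sup>1) p\<^sup>-\<^sup>1\<close>. Every similarity class of quaternions meets the closed upper half plane of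
  \<open>\<real> + \<real> i\<close> in exactly one point, because it is determined by real part and norm. This yields
  existence of the normal form (\<open>regular_loxodromic_pair_normal_form\<close>) and uniqueness of \<open>w\<close>.

  The remaining data are governed by what is left of the group. Two normal forms of the same pair
  differ by a matrix that is diagonal in the standard frame and also in the frame
  formed by the columns of \<^const>\<open>P_mat\<close>; comparing entries, it is a scalar quaternion \<open>q\<close> that
  commutes with \<open>w\<close> (\<open>normal_form_unique\<close>). It conjugates the eigenvalues \<open>r e\<^sup>I\<^sup>\<theta>\<close> of one form to those
  of the other, so the moduli and angles agree and the axes are conjugate by \<open>q\<close>; since the angles lie
  in the open interval \<open>(0, \<pi>)\<close>, the axes are determined by the eigenvalues (\<open>polar_unique\<close>).
  Conversely every unit \<open>q\<close> commuting with \<open>w\<close> preserves the shape of the normal form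
  (\<open>normal_form_conjugate\<close>).

  In the uniqueness argument the dynamics is replaced by linear algebra: an intertwiner of two diagonal
  matrices whose first entries have norm above one and second entries norm below one is
  diagonal (\<open>diag_intertwiner\<close>). Conjugating matrices are only ever modified by diagonal factors on
  the left, for which multiplicativity of the Dieudonne determinant is visible from its
  definition (\<open>dieudonne_det_diag_mult\<close>); membership in \<^const>\<open>SL2H\<close> is preserved for this reason.

  Topology enters only through the cross ratio, which is defined by attracting and repelling fixed
  points. For a diagonal matrix these are found directly, since it scales norms by a constant factor
  (\<open>attracting_diag_iff\<close>, \<open>repelling_diag_iff\<close>). They are transported to \<open>B\<close> by
  the frame matrix, because invertible matrices act on the one-point compactification by
  homeomorphisms (\<open>continuous_mobius\<close>). The attracting and repelling points
  are then \<open>\<infinity>, 0\<close> and \<open>1, w\<close>, with cross ratio \<open>(0 - 1)\<^sup>-\<^sup>1 (0 - w) = w\<close>.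
\<close>

section \<open>Quaternions\<close>

text \<open>The real part is a trace: it is symmetric in the two factors, hence invariant under
  conjugation. Together with the norm it is a complete invariant of a similarity class.\<close>

lemma qRe_mult_commute: "qRe (x * y) = qRe (y * x)"
  by simp

lemma qRe_conjugate:
  assumes "q \<noteq> 0"
  shows "qRe (q * x * inverse q) = qRe x"
proof -
  have "qRe (q * x * inverse q) = qRe (inverse q * (q * x))"
    by (rule qRe_mult_commute)
  also have "\<dots> = qRe x"
    using assms by (simp add: mult.assoc[symmetric])
  finally show ?thesis .
qed

lemma norm_conjugate:
  fixes q :: quat
  assumes "q \<noteq> 0"
  shows "norm (q * x * inverse q) = norm x"
  using assms by (simp add: norm_mult norm_inverse)

lemma conjugate_mult:
  fixes q :: quat
  assumes "q \<noteq> 0"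
  shows "(q * x * inverse q) * (q * y * inverse q) = q * (x * y) * inverse q"
proof -
  have "(q * x * inverse q) * (q * y * inverse q) = q * x * (inverse q * q) * y * inverse q"
    by (simp only: mult.assoc)
  then show ?thesis
    using assms by (simp add: mult.assoc)
qed

lemma conjugate_imag_units:
  assumes "q \<noteq> 0" "I \<in> imag_units"
  shows "q * I * inverse q \<in> imag_units"
  using assms by (simp add: imag_units_def power2_eq_square conjugate_mult)

lemma norm_quat_squared: "(norm x)\<^sup>2 = (qRe x)\<^sup>2 + (qI x)\<^sup>2 + (qJ x)\<^sup>2 + (qK x)\<^sup>2"
  by (simp add: norm_quat_def)

lemma imag_unitsD:
  assumes "I \<in> imag_units"
  shows "norm I = 1" "qRe I = 0"
proof -
  have sq: "I * I = -1"
    using assms by (simp add: imag_units_def power2_eq_square)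
  then have "norm I * norm I = 1"
    by (metis norm_minus_cancel norm_mult norm_one)
  then show norm: "norm I = 1"
    by (metis abs_norm_cancel power2_eq_square real_sqrt_abs real_sqrt_one)
  have "qRe (I * I) = -1"
    by (simp add: sq)
  then have "2 * (qRe I)\<^sup>2 = (norm I)\<^sup>2 - 1"
    unfolding norm_quat_squared by (simp add: power2_eq_square)
  then show "qRe I = 0"
    by (simp add: norm)
qed

lemma qRe_of_real [simp]: "qRe (of_real c) = c"
  and qI_of_real [simp]: "qI (of_real c) = 0"
  and qJ_of_real [simp]: "qJ (of_real c) = 0"
  and qK_of_real [simp]: "qK (of_real c) = 0"
  by (simp_all add: of_real_def)

lemma qRe_qcis: "I \<in> imag_units \<Longrightarrow> qRe (qcis I \<theta>) = cos \<theta>"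
  by (simp add: qcis_def imag_unitsD)

lemma norm_qcis:
  assumes "I \<in> imag_units"
  shows "norm (qcis I \<theta>) = 1"
proof -
  have 1: "(qI I)\<^sup>2 + (qJ I)\<^sup>2 + (qK I)\<^sup>2 = 1"
    using norm_quat_squared[of I] imag_unitsD[OF assms] by simp
  have "(norm (qcis I \<theta>))\<^sup>2 = (cos \<theta>)\<^sup>2 + ((qI I)\<^sup>2 + (qJ I)\<^sup>2 + (qK I)\<^sup>2) * (sin \<theta>)\<^sup>2"
    unfolding norm_quat_squared
    by (simp add: qcis_def imag_unitsD[OF assms] power_mult_distrib algebra_simps)
  also have "\<dots> = 1"
    by (simp add: 1)
  finally show ?thesis
    by (intro power2_eq_imp_eq[of "norm (qcis I \<theta>)" 1]) simp_all
qed

lemma norm_polar: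
  assumes "I \<in> imag_units" "0 < r"
  shows "norm (of_real r * qcis I \<theta>) = r"
  using assms by (simp add: norm_mult norm_qcis)

text \<open>Off the real axis the polar form determines modulus, angle and axis: the modulus is the
  norm, the angle comes from the real part because cosine is injective on \<open>(0, \<pi>)\<close>, and
  the axis is recovered by dividing by the sine, which does not vanish there.\<close>

lemma polar_unique:
  assumes eq: "of_real r * qcis I \<theta> = of_real r' * qcis I' \<theta>'"
    and pos: "0 < r" "0 < r'" and I: "I \<in> imag_units" "I' \<in> imag_units"
    and \<theta>: "\<theta> \<in> {0<..<pi}" "\<theta>' \<in> {0<..<pi}"
  shows "r = r' \<and> \<theta> = \<theta>' \<and> I = I'"
proof -
  have r: "r = r'"
    using arg_cong[OF eq, of norm] pos I by (simp only: norm_polar)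
  then have eq': "qcis I \<theta> = qcis I' \<theta>'"
    using eq pos by simp
  then have "cos \<theta> = cos \<theta>'"
    using I by (metis qRe_qcis)
  then have th: "\<theta> = \<theta>'"
    using \<theta> cos_inj_pi[of \<theta> \<theta>'] by auto
  have "sin \<theta> \<noteq> 0"
    using \<theta> sin_gt_zero[of \<theta>] by simp
  then have "I = I'"
    using eq' unfolding qcis_def th by simp
  with r th show ?thesis by simp
qed

lemma conjugate_polar:
  assumes "q \<noteq> 0"
  shows "q * (of_real r * qcis I \<theta>) * inverse q = of_real r * qcis (q * I * inverse q) \<theta>"
proof -
  have "q * qcis I \<theta> * inverse q
      = q * of_real (cos \<theta>) * inverse q + q * I * of_real (sin \<theta>) * inverse q"
    by (simp add: qcis_def algebra_simps)
  also have "\<dots> = of_real (cos \<theta>) * (q * inverse q) + q * I * inverse q * of_real (sin \<theta>)"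
    by (simp add: of_real_def)
  finally have "q * qcis I \<theta> * inverse q = qcis (q * I * inverse q) \<theta>"
    using assms by (simp add: qcis_def)
  then show ?thesis
    by (simp add: of_real_def)
qed

lemma closed_upper_half_plane_iff:
  "w \<in> closed_upper_half_plane \<longleftrightarrow> 0 \<le> qI w \<and> qJ w = 0 \<and> qK w = 0"
proof
  assume "w \<in> closed_upper_half_plane"
  then show "0 \<le> qI w \<and> qJ w = 0 \<and> qK w = 0"
    by (auto simp: closed_upper_half_plane_def quat_i_def of_real_def)
next
  assume "0 \<le> qI w \<and> qJ w = 0 \<and> qK w = 0"
  moreover from this have "w = of_real (qRe w) + of_real (qI w) * quat_i"
    by (simp add: quat_eq_iff quat_i_def of_real_def)
  ultimately show "w \<in> closed_upper_half_plane"
    unfolding closed_upper_half_plane_def by blast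
qed

text \<open>An imaginary unit \<open>u\<close> is carried to \<open>i\<close> by \<open>p = 1 - i u\<close>, because
  \<open>p u = u + i = i p\<close>. This fails only for \<open>p = 0\<close>, that is \<open>u = -i\<close>, and there
  \<open>j\<close> does the job.\<close>

lemma imag_unit_conjugate_to_i:
  assumes "u \<in> imag_units"
  obtains p where "p \<noteq> 0" "p * u = quat_i * p"
proof (cases "1 - quat_i * u = 0")
  case True
  then have "quat_i * (quat_i * u) = quat_i"
    by simp
  then have "u = - quat_i"
    by (simp add: mult.assoc[symmetric] quat_units minus_equation_iff)
  then have "quat_j * u = quat_i * quat_j"
    by (simp add: quat_units)
  moreover have "quat_j \<noteq> 0"
    by (simp add: quat_eq_iff quat_j_def)
  ultimately show ?thesis using that by blast
next
  case False
  have "u * u = -1"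
    using assms by (simp add: imag_units_def power2_eq_square)
  then have "(1 - quat_i * u) * u = quat_i * (1 - quat_i * u)"
    by (simp add: algebra_simps quat_units mult.assoc[symmetric])
  with False show ?thesis using that by blast
qed

lemma conjugate_into_closed_upper_half_plane:
  obtains p where "p \<noteq> 0" "p * z * inverse p \<in> closed_upper_half_plane"
proof -
  define v where "v = z - of_real (qRe z)"
  show ?thesis
  proof (cases "v = 0")
    case True
    then have "z \<in> closed_upper_half_plane"
      by (simp add: closed_upper_half_plane_iff v_def quat_eq_iff)
    with that[of 1] show ?thesis by simp
  next
    case False
    define u where "u = v /\<^sub>R norm v"
    have v: "v = of_real (norm v) * u"
      using False by (simp add: u_def of_real_def)
    have "v * v = - of_real ((norm v)\<^sup>2)"
      unfolding norm_quat_squared by (simp add: v_def quat_eq_iff power2_eq_square)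
    then have "u * u = -1"
      using False by (simp add: u_def of_real_def power2_eq_square field_simps)
    then obtain p where p: "p \<noteq> 0" "p * u = quat_i * p"
      using imag_unit_conjugate_to_i[of u] by (auto simp: imag_units_def power2_eq_square)
    have z: "z = of_real (qRe z) + of_real (norm v) * u"
      using v by (simp add: v_def)
    have "p * z = (of_real (qRe z) + of_real (norm v) * quat_i) * p"
      by (subst z) (simp add: algebra_simps of_real_def p)
    then have "p * z * inverse p = of_real (qRe z) + of_real (norm v) * quat_i"
      using p(1) by (simp add: mult.assoc)
    then have "p * z * inverse p \<in> closed_upper_half_plane"
      unfolding closed_upper_half_plane_def by fastforce
    with p(1) that show ?thesis by blast
  qed
qed

lemma closed_upper_half_plane_similar_unique:
  assumes "w \<in> closed_upper_half_plane" "w' \<in> closed_upper_half_plane" "q \<noteq> 0" "q * w = w' * q"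
  shows "w = w'"
proof -
  have w': "w' = q * w * inverse q"
    using assms(3,4) by (simp add: mult.assoc)
  have re: "qRe w' = qRe w" and n: "(norm w')\<^sup>2 = (norm w)\<^sup>2"
    unfolding w' by (simp_all only: qRe_conjugate[OF assms(3)] norm_conjugate[OF assms(3)])
  have "(qI w')\<^sup>2 = (qI w)\<^sup>2"
    using n re assms(1,2) unfolding norm_quat_squared closed_upper_half_plane_iff by simp
  then have "qI w' = qI w"
    using assms(1,2) by (simp add: closed_upper_half_plane_iff power2_eq_iff_nonneg)
  then show ?thesis
    using re assms(1,2) by (simp add: quat_eq_iff closed_upper_half_plane_iff)
qed

section \<open>Matrices\<close>

lemma mat2_sel [simp]:
  "mat2 a b c d $ 1 $ 1 = a" "mat2 a b c d $ 1 $ 2 = b"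
  "mat2 a b c d $ 2 $ 1 = c" "mat2 a b c d $ 2 $ 2 = d"
  by (simp_all add: mat2_def)

lemma mat2_eta: "A = mat2 (A$1$1) (A$1$2) (A$2$1) (A$2$2)"
  by (simp add: vec_eq_iff forall_2)

lemma mat2_cases:
  obtains a b c d where "A = mat2 a b c d"
  using mat2_eta by blast

lemma mat2_eq_iff [simp]:
  "mat2 a b c d = mat2 a' b' c' d' \<longleftrightarrow> a = a' \<and> b = b' \<and> c = c' \<and> d = d'"
  by (auto simp: vec_eq_iff forall_2)

lemma mat2_mult [simp]:
  "mat2 a b c d ** mat2 a' b' c' d'
    = mat2 (a * a' + b * c') (a * b' + b * d') (c * a' + d * c') (c * b' + d * d')"
  by (simp add: vec_eq_iff forall_2 matrix_matrix_mult_def sum_2)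

lemma mat2_one: "mat 1 = mat2 1 0 0 1"
  by (simp add: vec_eq_iff forall_2 mat_def)

lemma scaleR_mat2: "c *\<^sub>R mat2 a b a' b' = mat2 (c *\<^sub>R a) (c *\<^sub>R b) (c *\<^sub>R a') (c *\<^sub>R b')"
  by (simp add: vec_eq_iff forall_2)

lemma matrix_inv_left_right:
  fixes A :: "quat^2^2"
  assumes "invertible A"
  shows "A ** matrix_inv A = mat 1" "matrix_inv A ** A = mat 1"
  using someI_ex[OF assms[unfolded invertible_def]] by (simp_all add: matrix_inv_def)

lemma matrix_inv_unique:
  fixes A :: "quat^2^2"
  assumes "A ** B = mat 1" "B ** A = mat 1"
  shows "invertible A" "matrix_inv A = B"
proof -
  show inv: "invertible A"
    using assms by (auto simp: invertible_def)
  have "matrix_inv A = matrix_inv A ** (A ** B)"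
    by (simp add: assms)
  also have "\<dots> = B"
    by (simp add: matrix_mul_assoc matrix_inv_left_right[OF inv])
  finally show "matrix_inv A = B" .
qed

lemma invertible_matrix_inv:
  fixes A :: "quat^2^2"
  assumes "invertible A"
  shows "invertible (matrix_inv A)" "matrix_inv (matrix_inv A) = A"
  using matrix_inv_unique[of "matrix_inv A" A] matrix_inv_left_right[OF assms] by simp_all

lemma matrix_inv_mult:
  fixes A B :: "quat^2^2"
  assumes "invertible A" "invertible B"
  shows "matrix_inv (A ** B) = matrix_inv B ** matrix_inv A"
proof (rule matrix_inv_unique)
  have "A ** B ** (matrix_inv B ** matrix_inv A) = A ** (B ** matrix_inv B) ** matrix_inv A"
    by (simp only: matrix_mul_assoc)
  then show "A ** B ** (matrix_inv B ** matrix_inv A) = mat 1"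
    by (simp add: matrix_inv_left_right assms)
  have "matrix_inv B ** matrix_inv A ** (A ** B) = matrix_inv B ** (matrix_inv A ** A) ** B"
    by (simp only: matrix_mul_assoc)
  then show "matrix_inv B ** matrix_inv A ** (A ** B) = mat 1"
    by (simp add: matrix_inv_left_right assms)
qed

lemma invertible_conj:
  fixes g A :: "quat^2^2"
  assumes "invertible g" "invertible A"
  shows "invertible (g ** A ** matrix_inv g)"
  using assms by (intro invertible_mult invertible_matrix_inv)

lemma matrix_conj_conj:
  fixes g h A :: "quat^2^2"
  assumes "invertible g" "invertible h"
  shows "g ** (h ** A ** matrix_inv h) ** matrix_inv g = (g ** h) ** A ** matrix_inv (g ** h)"
  by (simp add: matrix_inv_mult assms matrix_mul_assoc)

lemma diag_inverse:
  assumes "p \<noteq> 0" "q \<noteq> 0"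
  shows "invertible (mat2 p 0 0 q)" "matrix_inv (mat2 p 0 0 q) = mat2 (inverse p) 0 0 (inverse q)"
  using assms
  by (auto intro!: matrix_inv_unique[of "mat2 p 0 0 q" "mat2 (inverse p) 0 0 (inverse q)"]
           simp: mat2_one)

lemma diag_conj_loxodromic_diag:
  assumes "p \<noteq> 0" "q \<noteq> 0"
  shows "mat2 p 0 0 q ** loxodromic_diag r \<theta> \<phi> I J ** matrix_inv (mat2 p 0 0 q)
    = loxodromic_diag r \<theta> \<phi> (p * I * inverse p) (q * J * inverse q)"
  using assms by (simp add: loxodromic_diag_def diag_inverse conjugate_polar del: of_real_inverse)

lemma invertible_diag_nonzero:
  assumes "invertible (mat2 p 0 0 q)"
  shows "p \<noteq> 0" "q \<noteq> 0"
proof -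
  obtain B where B: "mat2 p 0 0 q ** B = mat 1"
    using assms by (auto simp: invertible_def)
  obtain a b c d where "B = mat2 a b c d"
    by (rule mat2_cases)
  with B show "p \<noteq> 0" "q \<noteq> 0"
    by (auto simp: mat2_one)
qed

text \<open>A matrix intertwining two diagonal matrices with \<open>|\<alpha>| > 1 > |\<mu>|\<close> is diagonal,
  since an off-diagonal entry \<open>b \<noteq> 0\<close> would satisfy \<open>b \<mu> = \<alpha>' b\<close> and force
  \<open>|\<mu>| = |\<alpha>'|\<close>. This is the algebraic form of the fact that a conjugating
  map matches attracting with attracting and repelling with repelling fixed points.\<close>

lemma diag_intertwiner:
  assumes "mat2 a b c d ** mat2 \<alpha> 0 0 \<mu> = mat2 \<alpha>' 0 0 \<mu>' ** mat2 a b c d"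
    and "norm \<mu> < 1" "1 < norm \<alpha>" "norm \<mu>' < 1" "1 < norm \<alpha>'"
  shows "b = 0" "c = 0" "a * \<alpha> = \<alpha>' * a" "d * \<mu> = \<mu>' * d"
proof -
  have b: "b * \<mu> = \<alpha>' * b" and c: "c * \<alpha> = \<mu>' * c"
    using assms(1) by simp_all
  show "b = 0"
    using arg_cong[OF b, of norm] assms(2,5) by (auto simp: norm_mult)
  show "c = 0"
    using arg_cong[OF c, of norm] assms(3,4) by (auto simp: norm_mult)
  show "a * \<alpha> = \<alpha>' * a" "d * \<mu> = \<mu>' * d"
    using assms(1) by simp_all
qed

lemma SL2H_invertible: "g \<in> SL2H \<Longrightarrow> invertible g"
  by (simp add: SL2H_def)

lemma dieudonne_det_diag_mult:
  assumes "p \<noteq> 0"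
  shows "dieudonne_det (mat2 p 0 0 q ** g) = norm p * norm q * dieudonne_det g"
proof -
  obtain a b c d where g: "g = mat2 a b c d"
    by (rule mat2_cases)
  show ?thesis
  proof (cases "a = 0")
    case True
    then show ?thesis
      by (simp add: g dieudonne_det_def Let_def norm_mult)
  next
    case False
    have "norm (p * a * (q * d) - p * a * (q * c) * inverse (p * a) * (p * b))
        = norm (p * a * q * (d - c * inverse a * b))"
    proof -
      have "inverse (p * a) = inverse a * inverse p"
        using assms False by (simp add: nonzero_inverse_mult_distrib)
      then have "inverse (p * a) * (p * b) = inverse a * (inverse p * p) * b"
        by (simp only: mult.assoc)
      then have cancel: "inverse (p * a) * (p * b) = inverse a * b"
        using assms by simp
      have "p * a * (q * d) - p * a * (q * c) * inverse (p * a) * (p * b)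
          = p * a * (q * d) - p * a * (q * c) * (inverse (p * a) * (p * b))"
        by (simp only: mult.assoc)
      also have "\<dots> = p * a * q * (d - c * inverse a * b)"
        unfolding cancel by (simp only: right_diff_distrib mult.assoc)
      finally show ?thesis by simp
    qed
    also have "\<dots> = norm p * norm q * norm (a * (d - c * inverse a * b))"
      by (simp add: norm_mult)
    also have "a * (d - c * inverse a * b) = a * d - a * c * inverse a * b"
      by (simp add: algebra_simps)
    finally show ?thesis
      using assms False by (simp add: g dieudonne_det_def Let_def)
  qed
qed

lemma diag_mult_SL2H:
  assumes "g \<in> SL2H" "norm p * norm q = 1"
  shows "mat2 p 0 0 q ** g \<in> SL2H"
proof -
  have "p \<noteq> 0" "q \<noteq> 0"
    using assms(2) by auto
  then show ?thesis
    using assms by (simp add: SL2H_def invertible_mult diag_inverse dieudonne_det_diag_mult)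
qed

section \<open>Moebius transformations\<close>

text \<open>The point of the projective line with homogeneous coordinates \<open>(x, y)\<close>, taken up to
  multiplication by a nonzero quaternion from the right.\<close>

definition proj :: "quat \<Rightarrow> quat \<Rightarrow> quat option" where
  "proj x y = (if y = 0 then None else Some (x * inverse y))"

lemma proj_cases:
  obtains x y where "z = proj x y" "x \<noteq> 0 \<or> y \<noteq> 0"
proof (cases z)
  case None
  with that[of 1 0] show ?thesis by (simp add: proj_def)
next
  case (Some x)
  with that[of x 1] show ?thesis by (simp add: proj_def)
qed

text \<open>In homogeneous coordinates a Moebius transformation is linear; this is what makes
  composition of transformations correspond to multiplication of matrices.\<close>

lemma mobius_proj:
  assumes "x \<noteq> 0 \<or> y \<noteq> 0"
  shows "mobius (mat2 a b c d) (proj x y) = proj (a * x + b * y) (c * x + d * y)"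
proof (cases "y = 0")
  case True
  have "a * x * inverse (c * x) = a * inverse c" if "c \<noteq> 0"
  proof -
    have "inverse (c * x) = inverse x * inverse c"
      using that assms True by (simp add: nonzero_inverse_mult_distrib)
    then have "a * x * inverse (c * x) = a * (x * inverse x) * inverse c"
      by (simp only: mult.assoc)
    then show ?thesis using assms True by simp
  qed
  then show ?thesis
    using True assms by (simp add: mobius_def proj_def)
next
  case False
  have num: "a * (x * inverse y) + b = (a * x + b * y) * inverse y"
    and den: "c * (x * inverse y) + d = (c * x + d * y) * inverse y"
    using False by (simp_all add: distrib_right mult.assoc)
  have "(a * x + b * y) * inverse y * inverse ((c * x + d * y) * inverse y)
      = (a * x + b * y) * inverse (c * x + d * y)" if "c * x + d * y \<noteq> 0"
  proof -
    have "inverse ((c * x + d * y) * inverse y) = y * inverse (c * x + d * y)"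
      using that False by (simp add: nonzero_inverse_mult_distrib)
    then have "(a * x + b * y) * inverse y * inverse ((c * x + d * y) * inverse y)
        = (a * x + b * y) * (inverse y * y) * inverse (c * x + d * y)"
      by (simp only: mult.assoc)
    then show ?thesis using False by simp
  qed
  then show ?thesis
    using False by (simp add: mobius_def proj_def num den)
qed

lemma invertible_apply_nonzero:
  assumes "invertible (mat2 a b c d)" "x \<noteq> 0 \<or> y \<noteq> 0"
  shows "a * x + b * y \<noteq> 0 \<or> c * x + d * y \<noteq> 0"
proof (rule ccontr)
  assume "\<not> ?thesis"
  then have zero: "a * x + b * y = 0" "c * x + d * y = 0"
    by simp_all
  obtain e f g h where "mat2 e f g h ** mat2 a b c d = mat 1"
    using assms(1) mat2_cases by (metis invertible_def)
  then have one: "e * a + f * c = 1" "e * b + f * d = 0" "g * a + h * c = 0" "g * b + h * d = 1"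
    by (simp_all add: mat2_one)
  have "x = (e * a + f * c) * x + (e * b + f * d) * y"
    by (simp add: one)
  also have "\<dots> = e * (a * x + b * y) + f * (c * x + d * y)"
    by (simp add: algebra_simps)
  finally have "x = 0" by (simp add: zero)
  have "y = (g * a + h * c) * x + (g * b + h * d) * y"
    by (simp add: one)
  also have "\<dots> = g * (a * x + b * y) + h * (c * x + d * y)"
    by (simp add: algebra_simps)
  finally have "y = 0" by (simp add: zero)
  with \<open>x = 0\<close> assms(2) show False by simp
qed

lemma mobius_mult:
  assumes "invertible B"
  shows "mobius (A ** B) z = mobius A (mobius B z)"
proof -
  obtain x y where z: "z = proj x y" "x \<noteq> 0 \<or> y \<noteq> 0"
    by (rule proj_cases)
  obtain a b c d where A: "A = mat2 a b c d" by (rule mat2_cases)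
  obtain e f g h where B: "B = mat2 e f g h" by (rule mat2_cases)
  show ?thesis
    using invertible_apply_nonzero[OF assms[unfolded B] z(2)] z(2)
    by (simp add: A B z(1) mobius_proj algebra_simps)
qed

lemma mobius_one [simp]: "mobius (mat 1) z = z"
  by (cases z) (simp_all add: mat2_one mobius_def)

lemma mobius_matrix_inv:
  assumes "invertible A"
  shows "mobius A (mobius (matrix_inv A) z) = z" "mobius (matrix_inv A) (mobius A z) = z"
  using assms
  by (simp_all add: mobius_mult[symmetric] invertible_matrix_inv matrix_inv_left_right)

lemma mobius_conj:
  assumes "invertible g" "invertible A"
  shows "mobius (g ** A ** matrix_inv g) z = mobius g (mobius A (mobius (matrix_inv g) z))"
  using assms by (simp add: mobius_mult invertible_matrix_inv)

lemma fixed_points_conj: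
  assumes "invertible g" "invertible A" "p \<in> fixed_points A"
  shows "mobius g p \<in> fixed_points (g ** A ** matrix_inv g)"
  using assms by (simp add: fixed_points_def mobius_conj mobius_matrix_inv)

section \<open>Continuity of Moebius transformations\<close>

lemma openin_hat_iff:
  "openin hat_topology U \<longleftrightarrow>
     open (Some -` U) \<and> (None \<in> U \<longrightarrow> bounded (- (Some -` U)))"
proof
  assume "openin hat_topology U"
  then consider V where "open V" "U = Some ` V"
    | C where "compact C" "U = insert None (Some ` (- C))"
    unfolding hat_topology_def openin_Alexandroff_compactification
    by (auto simp: Compl_eq_Diff_UNIV)
  then show "open (Some -` U) \<and> (None \<in> U \<longrightarrow> bounded (- (Some -` U)))"
  proof cases
    case 1
    then have "Some -` U = V" by auto
    with 1 show ?thesis by auto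
  next
    case 2
    then have "Some -` U = - C" by auto
    with 2 show ?thesis by (auto intro: compact_imp_bounded compact_imp_closed open_Compl)
  qed
next
  assume U: "open (Some -` U) \<and> (None \<in> U \<longrightarrow> bounded (- (Some -` U)))"
  show "openin hat_topology U"
  proof (cases "None \<in> U")
    case True
    then have "compact (- (Some -` U))"
      using U by (simp add: compact_eq_bounded_closed closed_Compl)
    moreover have "U = insert None (Some ` (UNIV - (- (Some -` U))))"
      using True by (auto simp: image_iff)
    ultimately show ?thesis
      unfolding hat_topology_def openin_Alexandroff_compactification
      by (metis closed_closedin compact_imp_closed compactin_euclidean_iff topspace_euclidean)
  next
    case False
    then have "U = Some ` (Some -` U)"
      by (auto simp: image_iff) (metis not_None_eq)
    with U show ?thesis
      unfolding hat_topology_def openin_Alexandroff_compactification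
      by (metis open_openin)
  qed
qed

lemma topspace_hat [simp]: "topspace hat_topology = UNIV"
  by (auto simp: hat_topology_def notin_range_Some)

text \<open>Affine maps and the inversion generate all Moebius transformations: with
  \<open>c \<noteq> 0\<close> one has
  \<open>(a x + b) (c x + d)\<^sup>-\<^sup>1 = a c\<^sup>-\<^sup>1 + (b - a c\<^sup>-\<^sup>1 d) (c x + d)\<^sup>-\<^sup>1\<close>.
  Continuity at infinity therefore needs to be checked for these two kinds of maps only.\<close>

definition affine_hat :: "quat \<Rightarrow> quat \<Rightarrow> quat \<Rightarrow> quat option \<Rightarrow> quat option" where
  "affine_hat a b d = map_option (\<lambda>x. a * x * d + b)"

definition inversion_hat :: "quat option \<Rightarrow> quat option" where
  "inversion_hat z = (case z of None \<Rightarrow> Some 0 | Some x \<Rightarrow> if x = 0 then None else Some (inverse x))"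

lemma continuous_affine_hat:
  assumes "a \<noteq> 0" "d \<noteq> 0"
  shows "continuous_map hat_topology hat_topology (affine_hat a b d)"
  unfolding continuous_map
proof (intro conjI allI impI)
  fix W assume W: "openin hat_topology W"
  define f where "f x = a * x * d + b" for x
  define g where "g y = inverse a * (y - b) * inverse d" for y
  have gf: "g (f x) = x" for x
  proof -
    have "g (f x) = (inverse a * a) * x * (d * inverse d)"
      unfolding g_def f_def by (simp add: mult.assoc)
    then show ?thesis using assms by simp
  qed
  define S where "S = Some -` {z. affine_hat a b d z \<in> W}"
  have S: "S = f -` (Some -` W)"
    by (auto simp: S_def affine_hat_def f_def)
  have "open S"
    unfolding S using W by (intro open_vimage) (auto simp: openin_hat_iff f_def intro!: continuous_intros)
  moreover have "bounded (- S)" if "None \<in> W"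
  proof -
    have "bounded (- (Some -` W))"
      using W that by (simp add: openin_hat_iff)
    then obtain R where R: "\<And>y. y \<in> - (Some -` W) \<Longrightarrow> norm y \<le> R"
      by (auto simp: bounded_iff)
    have "norm x \<le> norm (inverse a) * (R + norm b) * norm (inverse d)" if "x \<in> - S" for x
    proof -
      have "norm (f x) \<le> R"
        using that R by (auto simp: S)
      then have "norm (f x - b) \<le> R + norm b"
        using norm_triangle_ineq4[of "f x" b] by linarith
      then have "norm (g (f x)) \<le> norm (inverse a) * (R + norm b) * norm (inverse d)"
        unfolding g_def norm_mult by (intro mult_right_mono mult_left_mono) auto
      then show ?thesis by (simp add: gf)
    qed
    then show ?thesis by (auto simp: bounded_iff)
  qed
  ultimately show "openin hat_topology {z \<in> topspace hat_topology. affine_hat a b d z \<in> W}"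
    unfolding openin_hat_iff S_def by (auto simp: affine_hat_def)
qed simp

lemma continuous_inversion_hat: "continuous_map hat_topology hat_topology inversion_hat"
  unfolding continuous_map
proof (intro conjI allI impI)
  fix W assume W: "openin hat_topology W"
  define V where "V = Some -` W"
  define S where "S = Some -` {z. inversion_hat z \<in> W}"
  have V: "open V" "None \<in> W \<Longrightarrow> bounded (- V)"
    using W by (simp_all add: openin_hat_iff V_def)
  have S_iff: "x \<in> S \<longleftrightarrow> (if x = 0 then None \<in> W else inverse x \<in> V)" for x
    by (simp add: S_def V_def inversion_hat_def)
  have "open (- {0} \<inter> inverse -` V)"
    using V by (intro continuous_open_preimage) (auto intro!: continuous_intros)
  moreover have "- {0} \<inter> inverse -` V = S - {0}"
    by (auto simp: S_iff)
  ultimately have open0: "open (S - {0})" by simp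
  have "open S"
  proof (cases "None \<in> W")
    case True
    then obtain R where R: "0 < R" "\<And>y. y \<in> - V \<Longrightarrow> norm y \<le> R"
      using V by (metis bounded_pos)
    have "ball 0 (inverse R) \<subseteq> S"
    proof
      fix x :: quat assume "x \<in> ball 0 (inverse R)"
      then have "R < norm (inverse x)" if "x \<noteq> 0"
        using that R(1) by (simp add: norm_inverse less_imp_inverse_less[of "norm x" "inverse R", simplified])
      then show "x \<in> S"
        using True R(2) by (fastforce simp: S_iff)
    qed
    then have "S = (S - {0}) \<union> ball 0 (inverse R)"
      using R(1) by auto
    with open0 show ?thesis
      by (metis open_Un open_ball)
  next
    case False
    then have "S - {0} = S" by (auto simp: S_iff)
    with open0 show ?thesis by simp
  qed
  moreover have "bounded (- S)" if "Some 0 \<in> W"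
  proof -
    have "0 \<in> V" using that by (simp add: V_def)
    then obtain e where e: "0 < e" "ball 0 e \<subseteq> V"
      using V(1) open_contains_ball by blast
    have "norm x \<le> inverse e" if "x \<in> - S" for x
    proof (rule ccontr)
      assume *: "\<not> norm x \<le> inverse e"
      have "inverse e > 0" using e(1) by simp
      then have "x \<noteq> 0" using * by auto
      have "norm (inverse x) < e"
        using * e(1) less_imp_inverse_less[of "inverse e" "norm x"] by (simp add: norm_inverse)
      then have "inverse x \<in> V" using e(2) by auto
      then show False using that \<open>x \<noteq> 0\<close> by (simp add: S_iff)
    qed
    then show ?thesis by (auto simp: bounded_iff)
  qed
  ultimately show "openin hat_topology {z \<in> topspace hat_topology. inversion_hat z \<in> W}"
    unfolding openin_hat_iff S_def by (auto simp: inversion_hat_def)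
qed simp

lemma continuous_mobius:
  assumes "invertible A"
  shows "continuous_map hat_topology hat_topology (mobius A)"
proof -
  obtain a b c d where A: "A = mat2 a b c d" by (rule mat2_cases)
  show ?thesis
  proof (cases "c = 0")
    case True
    have "a \<noteq> 0"
      using invertible_apply_nonzero[OF assms[unfolded A], of 1 0] True by simp
    \<comment> \<open>The vector \<open>(- a\<^sup>-\<^sup>1 b, 1)\<close> is annihilated by the first row.\<close>
    moreover have "d \<noteq> 0"
      using invertible_apply_nonzero[OF assms[unfolded A], of "- (inverse a * b)" 1] True \<open>a \<noteq> 0\<close>
      by (simp add: mult.assoc[symmetric])
    moreover have "mobius A = affine_hat a (b * inverse d) (inverse d)"
      using \<open>d \<noteq> 0\<close> True
      by (auto simp: A mobius_def affine_hat_def distrib_right split: option.split)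
    ultimately show ?thesis
      by (simp add: continuous_affine_hat)
  next
    case False
    define e where "e = b - a * inverse c * d"
    have "e \<noteq> 0"
      using invertible_apply_nonzero[OF assms[unfolded A], of "- (inverse c * d)" 1] False
      by (simp add: mult.assoc[symmetric] e_def)
    have "(a * x + b) * inverse (c * x + d) = a * inverse c + e * inverse (c * x + d)"
      if "c * x + d \<noteq> 0" for x
    proof -
      have "a * inverse c * (c * x + d) = a * (inverse c * c) * x + a * inverse c * d"
        by (simp only: distrib_left mult.assoc)
      then have "a * x + b = a * inverse c * (c * x + d) + e"
        using False by (simp add: e_def)
      then have "(a * x + b) * inverse (c * x + d)
          = a * inverse c * ((c * x + d) * inverse (c * x + d)) + e * inverse (c * x + d)"
        by (simp only: distrib_right mult.assoc)
      then show ?thesis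
        using that by simp
    qed
    then have "mobius A = affine_hat e (a * inverse c) 1 \<circ> inversion_hat \<circ> affine_hat c d 1"
      using False
      by (auto simp: fun_eq_iff A mobius_def affine_hat_def inversion_hat_def split: option.split)
    then show ?thesis
      using False \<open>e \<noteq> 0\<close>
      by (auto intro!: continuous_map_compose continuous_affine_hat continuous_inversion_hat)
  qed
qed

section \<open>Attracting and repelling fixed points\<close>

lemma funpow_mobius_conj:
  assumes "invertible g" "invertible A"
  shows "(mobius (g ** A ** matrix_inv g) ^^ n) (mobius g z) = mobius g ((mobius A ^^ n) z)"
  using assms by (induction n) (simp_all add: mobius_conj mobius_matrix_inv)

text \<open>Since \<open>g\<close> acts by a homeomorphism, it carries the neighbourhood that witnesses
  attraction, and the neighbourhoods it is attracted into, to neighbourhoods of the image.\<close>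

lemma attracting_fixed_point_conj:
  assumes g: "invertible g" and A: "invertible A" and p: "attracting_fixed_point A p"
  shows "attracting_fixed_point (g ** A ** matrix_inv g) (mobius g p)"
proof -
  define G where "G U = {z. mobius (matrix_inv g) z \<in> U}" for U
  define F where "F V = {z. mobius g z \<in> V}" for V
  have G_open: "openin hat_topology (G U)" if "openin hat_topology U" for U
    using openin_continuous_map_preimage[OF continuous_mobius[OF invertible_matrix_inv(1)[OF g]] that]
    by (simp add: G_def)
  have F_open: "openin hat_topology (F V)" if "openin hat_topology V" for V
    using openin_continuous_map_preimage[OF continuous_mobius[OF g] that]
    by (simp add: F_def)
  obtain U where U: "openin hat_topology U" "p \<in> U"
    and attr: "\<And>V. openin hat_topology V \<Longrightarrow> p \<in> V \<Longrightarrow> \<forall>\<^sub>F n in sequentially. (mobius A ^^ n) ` U \<subseteq> V"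
    using p unfolding attracting_fixed_point_def by blast
  have "\<forall>\<^sub>F n in sequentially. (mobius (g ** A ** matrix_inv g) ^^ n) ` G U \<subseteq> V"
    if "openin hat_topology V" "mobius g p \<in> V" for V
  proof -
    have "\<forall>\<^sub>F n in sequentially. (mobius A ^^ n) ` U \<subseteq> F V"
      using that by (intro attr F_open) (simp_all add: F_def)
    then show ?thesis
    proof (rule eventually_mono)
      fix n assume n: "(mobius A ^^ n) ` U \<subseteq> F V"
      have "(mobius (g ** A ** matrix_inv g) ^^ n) z \<in> V" if "z \<in> G U" for z
      proof -
        define y where "y = mobius (matrix_inv g) z"
        have "z = mobius g y" "y \<in> U"
          using that g by (simp_all add: y_def mobius_matrix_inv G_def)
        then show ?thesis
          using n g A by (auto simp: funpow_mobius_conj F_def)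
      qed
      then show "(mobius (g ** A ** matrix_inv g) ^^ n) ` G U \<subseteq> V" by blast
    qed
  qed
  moreover have "mobius g p \<in> fixed_points (g ** A ** matrix_inv g)"
    using p g A by (simp add: fixed_points_conj attracting_fixed_point_def)
  moreover have "mobius g p \<in> G U"
    using U g by (simp add: G_def mobius_matrix_inv)
  ultimately show ?thesis
    unfolding attracting_fixed_point_def using G_open[OF U(1)] by blast
qed

lemma attracting_fixed_point_conj_iff:
  assumes g: "invertible g" and A: "invertible A"
  shows "attracting_fixed_point (g ** A ** matrix_inv g) p
    \<longleftrightarrow> attracting_fixed_point A (mobius (matrix_inv g) p)"
proof
  assume "attracting_fixed_point (g ** A ** matrix_inv g) p"
  then have "attracting_fixed_point
      (matrix_inv g ** (g ** A ** matrix_inv g) ** matrix_inv (matrix_inv g)) (mobius (matrix_inv g) p)"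
    using g A by (intro attracting_fixed_point_conj invertible_matrix_inv invertible_conj)
  also have "matrix_inv g ** (g ** A ** matrix_inv g) ** matrix_inv (matrix_inv g) = A"
    unfolding matrix_conj_conj[OF invertible_matrix_inv(1)[OF g] g]
    by (metis g matrix_inv_left_right(2) matrix_inv_unique(2) matrix_mul_lid matrix_mul_rid)
  finally show "attracting_fixed_point A (mobius (matrix_inv g) p)" .
next
  assume "attracting_fixed_point A (mobius (matrix_inv g) p)"
  from attracting_fixed_point_conj[OF g A this]
  show "attracting_fixed_point (g ** A ** matrix_inv g) p"
    using g by (simp add: mobius_matrix_inv)
qed

lemma repelling_fixed_point_conj_iff:
  assumes g: "invertible g" and A: "invertible A"
  shows "repelling_fixed_point (g ** A ** matrix_inv g) p
    \<longleftrightarrow> repelling_fixed_point A (mobius (matrix_inv g) p)"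
proof -
  have "matrix_inv (g ** A ** matrix_inv g) = g ** matrix_inv A ** matrix_inv g"
    using g A by (simp add: matrix_inv_mult invertible_mult invertible_matrix_inv matrix_mul_assoc)
  then show ?thesis
    using attracting_fixed_point_conj_iff[OF g invertible_matrix_inv(1)[OF A]]
    by (simp add: repelling_fixed_point_def)
qed

text \<open>A diagonal matrix with \<open>|\<delta>| < |\<alpha>|\<close> expands distances from the origin by the constant
  factor \<open>|\<alpha>| / |\<delta>| > 1\<close>, so the complement of the unit ball is swallowed by every
  neighbourhood of infinity, while no neighbourhood of the origin stays close to it.\<close>

lemma attracting_diag_iff:
  assumes "norm \<delta> < norm \<alpha>" "\<delta> \<noteq> 0"
  shows "attracting_fixed_point (mat2 \<alpha> 0 0 \<delta>) p \<longleftrightarrow> p = None"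
proof -
  define f where "f = mobius (mat2 \<alpha> 0 0 \<delta>)"
  define k where "k = norm \<alpha> / norm \<delta>"
  have k: "1 < k"
    using assms by (simp add: k_def)
  have f: "f None = None" "f (Some x) = Some (\<alpha> * x * inverse \<delta>)" for x
    using assms(2) by (simp_all add: f_def mobius_def)
  have f_None: "(f ^^ n) None = None" for n
    by (induction n) (simp_all add: f)
  have f_Some: "\<exists>y. (f ^^ n) (Some x) = Some y \<and> norm y = k ^ n * norm x" for n x
  proof (induction n)
    case (Suc n)
    then obtain y where "(f ^^ n) (Some x) = Some y" "norm y = k ^ n * norm x" by blast
    then show ?case
      by (simp add: f norm_mult norm_inverse k_def divide_inverse)
  qed simp
  show ?thesis
  proof
    assume p: "attracting_fixed_point (mat2 \<alpha> 0 0 \<delta>) p"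
    show "p = None"
    proof (rule ccontr)
      assume "p \<noteq> None"
      then obtain x where x: "p = Some x" by blast
      have "f (Some x) = Some x"
        using p by (simp add: x f_def attracting_fixed_point_def fixed_points_def)
      then have "norm x = k * norm x"
        using f_Some[of 1 x] by auto
      then have "x = 0"
        using k by simp
      obtain U where U: "openin hat_topology U" "Some 0 \<in> U"
        and attr: "\<And>V. openin hat_topology V \<Longrightarrow> Some 0 \<in> V \<Longrightarrow> \<forall>\<^sub>F n in sequentially. (f ^^ n) ` U \<subseteq> V"
        using p unfolding attracting_fixed_point_def x \<open>x = 0\<close> f_def by blast
      obtain e where e: "0 < e" "ball 0 e \<subseteq> Some -` U"
        using U by (metis openin_hat_iff open_contains_ball vimageI2)
      define y :: quat where "y = (e / 2) *\<^sub>R 1"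
      have y: "norm y = e / 2"
        using e(1) by (simp add: y_def)
      then have "y \<in> ball 0 e"
        using e(1) by simp
      then have yU: "Some y \<in> U"
        using e(2) by blast
      have "\<forall>\<^sub>F n in sequentially. (f ^^ n) ` U \<subseteq> Some ` ball 0 (e / 2)"
        using e(1) by (intro attr) (auto simp: openin_hat_iff inj_vimage_image_eq)
      then obtain n where n: "(f ^^ n) ` U \<subseteq> Some ` ball 0 (e / 2)"
        using eventually_happens'[OF sequentially_bot] by blast
      obtain z where z: "(f ^^ n) (Some y) = Some z" "norm z = k ^ n * norm y"
        using f_Some by blast
      have "Some z \<in> Some ` ball 0 (e / 2)"
        using n yU z(1) by (metis image_subset_iff)
      then have "k ^ n * (e / 2) < e / 2"
        using z(2) y by (auto simp: mult.commute)
      moreover have "1 \<le> k ^ n"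
        using k by simp
      ultimately show False
        using e(1) by (simp add: mult_less_cancel_right1)
    qed
  next
    assume p: "p = None"
    define U where "U = insert None (Some ` (- cball (0 :: quat) 1))"
    have "Some -` U = - cball 0 1"
      by (auto simp: U_def)
    then have "openin hat_topology U"
      unfolding openin_hat_iff by auto
    moreover have "\<forall>\<^sub>F n in sequentially. (f ^^ n) ` U \<subseteq> V"
      if V: "openin hat_topology V" "None \<in> V" for V
    proof -
      obtain R where R: "\<And>y. y \<notin> Some -` V \<Longrightarrow> norm y \<le> R"
        using V by (auto simp: openin_hat_iff bounded_iff)
      have "\<forall>\<^sub>F n in sequentially. R < k ^ n"
        using k real_arch_pow[of k]
        by (metis eventually_sequentiallyI less_le_trans power_increasing less_imp_le)
      then show ?thesis
      proof (rule eventually_mono)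
        fix n assume n: "R < k ^ n"
        have "(f ^^ n) (Some x) \<in> V" if "1 < norm x" for x
        proof -
          obtain y where y: "(f ^^ n) (Some x) = Some y" "norm y = k ^ n * norm x"
            using f_Some by blast
          have "k ^ n * 1 \<le> k ^ n * norm x"
            using that k by (intro mult_left_mono) auto
          then have "R < norm y"
            using n y(2) by simp
          then show ?thesis
            using R[of y] y(1) by fastforce
        qed
        then show "(f ^^ n) ` U \<subseteq> V"
          using V(2) by (auto simp: U_def f_None)
      qed
    qed
    ultimately show "attracting_fixed_point (mat2 \<alpha> 0 0 \<delta>) p"
      using f_None[of 1] unfolding attracting_fixed_point_def fixed_points_def p f_def[symmetric]
      by (auto intro!: exI[of _ U] simp: U_def)
  qed
qed

text \<open>Exchanging the two coordinates turns the inverse of a diagonal matrix into one of the kind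
  already treated, and exchanges the origin with infinity.\<close>

lemma repelling_diag_iff:
  assumes "norm \<delta> < norm \<alpha>" "\<delta> \<noteq> 0"
  shows "repelling_fixed_point (mat2 \<alpha> 0 0 \<delta>) p \<longleftrightarrow> p = Some 0"
proof -
  have "\<alpha> \<noteq> 0" using assms by auto
  define S where "S = mat2 0 1 1 0"
  have S: "invertible S" "matrix_inv S = S"
    using matrix_inv_unique[of S S] by (simp_all add: S_def mat2_one)
  have "matrix_inv (mat2 \<alpha> 0 0 \<delta>) = S ** mat2 (inverse \<delta>) 0 0 (inverse \<alpha>) ** matrix_inv S"
    unfolding S(2) using assms(2) \<open>\<alpha> \<noteq> 0\<close> by (simp add: diag_inverse S_def)
  moreover have "norm (inverse \<alpha>) < norm (inverse \<delta>)"
    using assms by (simp add: norm_inverse less_imp_inverse_less)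
  ultimately have "repelling_fixed_point (mat2 \<alpha> 0 0 \<delta>) p \<longleftrightarrow> mobius S p = None"
    unfolding repelling_fixed_point_def
    using attracting_fixed_point_conj_iff[OF S(1) diag_inverse(1)[of "inverse \<delta>" "inverse \<alpha>"], of p]
      attracting_diag_iff[of "inverse \<alpha>" "inverse \<delta>" "mobius S p"] S(2) assms(2) \<open>\<alpha> \<noteq> 0\<close>
    by simp
  also have "\<dots> \<longleftrightarrow> p = Some 0"
    by (cases p) (auto simp: S_def mobius_def)
  finally show ?thesis .
qed

lemma fixed_points_diag:
  "None \<in> fixed_points (mat2 \<alpha> 0 0 \<delta>)"
  "\<delta> \<noteq> 0 \<Longrightarrow> Some 0 \<in> fixed_points (mat2 \<alpha> 0 0 \<delta>)"
  by (simp_all add: fixed_points_def mobius_def)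

lemma attractor_repeller_conj_diag:
  assumes g: "invertible g" and "norm \<delta> < norm \<alpha>" "\<delta> \<noteq> 0"
  shows "attractor (g ** mat2 \<alpha> 0 0 \<delta> ** matrix_inv g) = mobius g None"
    and "repeller (g ** mat2 \<alpha> 0 0 \<delta> ** matrix_inv g) = mobius g (Some 0)"
proof -
  have "\<alpha> \<noteq> 0" using assms by auto
  then have D: "invertible (mat2 \<alpha> 0 0 \<delta>)"
    using assms by (simp add: diag_inverse)
  have eq: "mobius (matrix_inv g) p = q \<longleftrightarrow> p = mobius g q" for p q
    using g by (auto simp: mobius_matrix_inv)
  show "attractor (g ** mat2 \<alpha> 0 0 \<delta> ** matrix_inv g) = mobius g None"
    unfolding attractor_def attracting_fixed_point_conj_iff[OF g D] attracting_diag_iff[OF assms(2,3)] eq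
    by simp
  show "repeller (g ** mat2 \<alpha> 0 0 \<delta> ** matrix_inv g) = mobius g (Some 0)"
    unfolding repeller_def repelling_fixed_point_conj_iff[OF g D] repelling_diag_iff[OF assms(2,3)] eq
    by simp
qed

section \<open>The normal form\<close>

lemma norm_loxodromic_diag:
  assumes "1 < r" "I \<in> imag_units" "J \<in> imag_units"
  shows "1 < norm (of_real r * qcis I \<theta>)" "norm (of_real (inverse r) * qcis J \<phi>) < 1"
    "of_real (inverse r) * qcis J \<phi> \<noteq> 0"
proof -
  show "1 < norm (of_real r * qcis I \<theta>)"
    using assms norm_polar[of I r \<theta>] by simp
  have "norm (of_real (inverse r) * qcis J \<phi>) = inverse r"
    using assms by (intro norm_polar) auto
  moreover have "0 < inverse r" "inverse r < 1"
    using assms by (auto simp: inverse_less_1_iff)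
  ultimately show "norm (of_real (inverse r) * qcis J \<phi>) < 1"
    "of_real (inverse r) * qcis J \<phi> \<noteq> 0"
    by (metis, metis norm_zero less_irrefl)
qed

lemma invertible_loxodromic_diag:
  assumes "1 < r" "I \<in> imag_units" "J \<in> imag_units"
  shows "invertible (loxodromic_diag r \<theta> \<phi> I J)"
proof -
  have "of_real r * qcis I \<theta> \<noteq> 0"
    using norm_loxodromic_diag(1)[OF assms] by (metis norm_zero not_one_less_zero)
  then show ?thesis
    unfolding loxodromic_diag_def using norm_loxodromic_diag(3)[OF assms] by (intro diag_inverse)
qed

text \<open>The normalising factor of \<^const>\<open>P_mat\<close> makes its Dieudonne determinant equal to one. As
  a real scalar it drops out of conjugations, so that calculations may use
  the matrix without it. The columns are homogeneous coordinates of the points \<open>1\<close> and \<open>w\<close>.\<close>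

definition frame :: "quat \<Rightarrow> quat^2^2" where
  "frame w = mat2 1 w 1 1"

lemma invertible_frame:
  assumes "w \<noteq> 1"
  shows "invertible (frame w)"
proof (rule matrix_inv_unique)
  define u where "u = inverse (1 - w)"
  have u1: "u - w * u = 1" and u2: "u - u * w = 1"
    using right_inverse[of "1 - w"] left_inverse[of "1 - w"] assms
    by (simp_all add: u_def algebra_simps)
  show "frame w ** mat2 u (- (w * u)) (- u) u = mat 1"
    using u1 by (simp add: frame_def mat2_one algebra_simps)
  have "w * u = u * w"
    using u1 u2 by (metis diff_eq_eq add_left_cancel)
  then show "mat2 u (- (w * u)) (- u) u ** frame w = mat 1"
    using u2 by (simp add: frame_def mat2_one algebra_simps)
qed

lemma conjugate_scaled:
  fixes a x :: quat
  assumes "c \<noteq> 0"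
  shows "(of_real c * a) * x * inverse (of_real c * a) = a * x * inverse a"
  using assms by (cases "a = 0") (simp_all add: of_real_def inverse_scaleR_distrib)

lemma B_normal_frame:
  assumes "w \<noteq> 1"
  shows "B_normal s \<theta> \<phi> w K L = frame w ** loxodromic_diag s \<theta> \<phi> K L ** matrix_inv (frame w)"
proof -
  define \<kappa> where "\<kappa> = 1 / sqrt (norm (1 - w))"
  define c :: quat where "c = of_real \<kappa>"
  have "\<kappa> \<noteq> 0"
    using assms by (simp add: \<kappa>_def)
  then have c: "c \<noteq> 0" and conj_c: "c * x * inverse c = x" for x
    using conjugate_scaled[of \<kappa> 1 x] by (simp_all add: c_def)
  have P: "P_mat w = frame w ** mat2 c 0 0 c"
    unfolding P_mat_def \<kappa>_def[symmetric] by (simp add: frame_def scaleR_mat2 c_def of_real_def)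
  have "P_mat w ** loxodromic_diag s \<theta> \<phi> K L ** matrix_inv (P_mat w)
      = frame w ** (mat2 c 0 0 c ** loxodromic_diag s \<theta> \<phi> K L ** matrix_inv (mat2 c 0 0 c))
         ** matrix_inv (frame w)"
    unfolding P using c assms by (intro matrix_conj_conj[symmetric] invertible_frame diag_inverse)
  also have "mat2 c 0 0 c ** loxodromic_diag s \<theta> \<phi> K L ** matrix_inv (mat2 c 0 0 c)
      = loxodromic_diag s \<theta> \<phi> K L"
    by (simp only: diag_conj_loxodromic_diag[OF c c] conj_c)
  finally show ?thesis
    by (simp add: B_normal_def)
qed

lemma cross_ratio_normal_form:
  assumes "1 < r" "1 < s" "{I, J, K, L} \<subseteq> imag_units" "w \<noteq> 1"
  shows "cross_ratio_pair (loxodromic_diag r \<theta> \<phi> I J) (B_normal s \<theta>' \<phi>' w K L) = w"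
proof -
  have units: "I \<in> imag_units" "J \<in> imag_units" "K \<in> imag_units" "L \<in> imag_units"
    using assms(3) by simp_all
  note A = norm_loxodromic_diag[OF assms(1) units(1,2)]
    and B = norm_loxodromic_diag[OF assms(2) units(3,4)]
  note A' = less_trans[OF A(2) A(1)] A(3) and B' = less_trans[OF B(2) B(1)] B(3)
  have "attractor (loxodromic_diag r \<theta> \<phi> I J) = None"
    "repeller (loxodromic_diag r \<theta> \<phi> I J) = Some 0"
    unfolding loxodromic_diag_def attractor_def repeller_def
      attracting_diag_iff[OF A'] repelling_diag_iff[OF A'] by simp_all
  moreover have "attractor (B_normal s \<theta>' \<phi>' w K L) = Some 1"
    "repeller (B_normal s \<theta>' \<phi>' w K L) = Some w"
    unfolding B_normal_frame[OF assms(4)] loxodromic_diag_def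
      attractor_repeller_conj_diag[OF invertible_frame[OF assms(4)] B']
    by (simp_all add: frame_def mobius_def)
  ultimately show ?thesis
    by (simp add: cross_ratio_pair_def)
qed

section \<open>Existence\<close>

lemma matrix_conj_change_frame:
  fixes g h B :: "quat^2^2"
  assumes "invertible g" "invertible h"
  shows "g ** B ** matrix_inv g
    = (g ** matrix_inv h) ** (h ** B ** matrix_inv h) ** matrix_inv (g ** matrix_inv h)"
proof -
  have "g = g ** matrix_inv h ** h"
    using assms by (simp add: matrix_mul_assoc[symmetric] matrix_inv_left_right)
  moreover have "invertible (g ** matrix_inv h)"
    using assms by (intro invertible_mult invertible_matrix_inv)
  ultimately show ?thesis
    using matrix_conj_conj[of "g ** matrix_inv h" h B] assms by simp
qed

lemma fixed_points_conj_inv: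
  assumes g: "invertible g" and D: "invertible D" "g ** A ** matrix_inv g = D"
    and z: "z \<in> fixed_points D"
  shows "mobius (matrix_inv g) z \<in> fixed_points A"
proof -
  have "A = matrix_inv g ** D ** matrix_inv (matrix_inv g)"
    using matrix_conj_change_frame[of "mat 1" g A] g D(2) matrix_inv_unique[of "mat 1" "mat 1"]
    by (simp add: invertible_matrix_inv)
  then show ?thesis
    using fixed_points_conj[OF invertible_matrix_inv(1)[OF g] D(1) z] by simp
qed

text \<open>Once \<open>A\<close> and \<open>B\<close> are diagonalised separately, by \<open>g\<close> and \<open>h\<close>, the relative position of
  their fixed points is recorded by the matrix \<open>M = g h\<^sup>-\<^sup>1\<close>, whose columns are
  homogeneous coordinates of the fixed points of \<open>g B g\<^sup>-\<^sup>1\<close>; disjointness from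
  \<open>{0, \<infinity>}\<close> says that no entry of \<open>M\<close> vanishes. The remaining freedom is a diagonal matrix
  \<open>(p, q)\<close>. It maps \<open>x = m\<^sub>1\<^sub>1 m\<^sub>2\<^sub>1\<^sup>-\<^sup>1\<close> to \<open>1\<close> exactly if \<open>q = p x\<close>, and then the second fixed
  point \<open>y\<close> to a conjugate of \<open>y x\<^sup>-\<^sup>1\<close> by \<open>p\<close>, which a suitable \<open>p\<close> brings into the half
  plane. The modulus of \<open>p\<close> stays free until the determinant condition fixes it.\<close>

lemma regular_loxodromic_pair_normal_form:
  assumes "regular_loxodromic_pair A B"
  shows "\<exists>r \<theta> \<phi> s \<theta>' \<phi>' w I J K L. normal_form_of A B r \<theta> \<phi> s \<theta>' \<phi>' w I J K L"
proof -
  obtain g r \<theta> \<phi> I J where g: "g \<in> SL2H" and r: "1 < r"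
    and \<theta>: "\<theta> \<in> {0<..<pi}" "\<phi> \<in> {0<..<pi}" and I: "I \<in> imag_units" "J \<in> imag_units"
    and gA: "g ** A ** matrix_inv g = loxodromic_diag r \<theta> \<phi> I J"
    using assms unfolding regular_loxodromic_pair_def regular_loxodromic_def by blast
  obtain h s \<theta>' \<phi>' K L where h: "h \<in> SL2H" and s: "1 < s"
    and \<theta>': "\<theta>' \<in> {0<..<pi}" "\<phi>' \<in> {0<..<pi}" and K: "K \<in> imag_units" "L \<in> imag_units"
    and hB: "h ** B ** matrix_inv h = loxodromic_diag s \<theta>' \<phi>' K L"
    using assms unfolding regular_loxodromic_pair_def regular_loxodromic_def by blast
  have disj: "fixed_points A \<inter> fixed_points B = {}"
    using assms by (simp add: regular_loxodromic_pair_def)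
  have gi: "invertible g" and hi: "invertible h"
    using g h by (simp_all add: SL2H_invertible)
  define D where "D = loxodromic_diag r \<theta> \<phi> I J"
  define E where "E = loxodromic_diag s \<theta>' \<phi>' K L"
  have DE: "invertible D" "invertible E"
    unfolding D_def E_def using r s I K by (simp_all add: invertible_loxodromic_diag)
  have fix_D: "None \<in> fixed_points D" "Some 0 \<in> fixed_points D"
    and fix_E: "None \<in> fixed_points E" "Some 0 \<in> fixed_points E"
    unfolding D_def E_def loxodromic_diag_def
    using norm_loxodromic_diag(3)[OF r I] norm_loxodromic_diag(3)[OF s K]
    by (simp_all add: fixed_points_diag del: of_real_inverse)
  define M where "M = g ** matrix_inv h"
  have Mi: "invertible M"
    unfolding M_def using gi hi by (intro invertible_mult invertible_matrix_inv)
  have moved: "mobius M z \<noteq> z0" if "z \<in> fixed_points E" "z0 \<in> fixed_points D" for z z0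
  proof
    assume eq: "mobius M z = z0"
    have "mobius M z = mobius g (mobius (matrix_inv h) z)"
      unfolding M_def using hi by (intro mobius_mult invertible_matrix_inv)
    then have "mobius (matrix_inv h) z = mobius (matrix_inv g) z0"
      using eq gi by (metis mobius_matrix_inv(2))
    moreover have "mobius (matrix_inv h) z \<in> fixed_points B"
      using fixed_points_conj_inv[OF hi DE(2) hB[folded E_def] that(1)] .
    moreover have "mobius (matrix_inv g) z0 \<in> fixed_points A"
      using fixed_points_conj_inv[OF gi DE(1) gA[folded D_def] that(2)] .
    ultimately show False
      using disj by auto
  qed
  obtain m11 m12 m21 m22 where M: "M = mat2 m11 m12 m21 m22"
    by (rule mat2_cases)
  have m: "m11 \<noteq> 0" "m12 \<noteq> 0" "m21 \<noteq> 0" "m22 \<noteq> 0"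
    using moved[OF fix_E(1) fix_D(1)] moved[OF fix_E(1) fix_D(2)]
      moved[OF fix_E(2) fix_D(1)] moved[OF fix_E(2) fix_D(2)]
    by (auto simp: M mobius_def split: if_splits)
  define x where "x = m11 * inverse m21"
  define y where "y = m12 * inverse m22"
  have xy: "x \<noteq> 0" "y \<noteq> 0" "x * m21 = m11" "y * m22 = m12"
    using m by (simp_all add: x_def y_def mult.assoc)
  obtain p0 where p0: "p0 \<noteq> 0" "p0 * (y * inverse x) * inverse p0 \<in> closed_upper_half_plane"
    by (rule conjugate_into_closed_upper_half_plane)
  define c where "c = 1 / (norm p0 * sqrt (norm x))"
  define p where "p = of_real c * p0"
  define q where "q = p * x"
  define w where "w = p * (y * inverse x) * inverse p"
  have c: "0 < c"
    using p0(1) xy(1) by (simp add: c_def)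
  have pq: "p \<noteq> 0" "q \<noteq> 0"
    using c p0(1) xy(1) by (simp_all add: p_def q_def)
  have "norm p = c * norm p0"
    using c by (simp add: p_def norm_mult)
  then have "norm p * sqrt (norm x) = 1"
    using p0(1) xy(1) by (simp add: c_def)
  then have "(norm p * norm p) * (sqrt (norm x) * sqrt (norm x)) = 1"
    by (metis mult.left_commute mult.assoc mult_1)
  then have "norm p * norm p * norm x = 1"
    by simp
  then have det: "norm p * norm q = 1"
    by (simp add: q_def norm_mult mult.assoc)
  have w_half: "w \<in> closed_upper_half_plane"
    using p0(2) c conjugate_scaled[of c p0] by (simp add: w_def p_def)
  have w0: "w \<noteq> 0"
    using pq xy by (simp add: w_def)
  define k where "k = mat2 p 0 0 q"
  define t where "t = p * m11"
  define u where "u = q * m22"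
  have tu: "t \<noteq> 0" "u \<noteq> 0"
    using pq m by (simp_all add: t_def u_def)
  have "w * u = p * y * (inverse x * (inverse p * p) * x) * m22"
    by (simp only: w_def u_def q_def mult.assoc)
  also have "\<dots> = p * m12"
    using pq xy(1) by (simp add: mult.assoc xy(4))
  finally have kM: "k ** M = mat2 t (w * u) t u"
    using xy(3) by (simp add: k_def M t_def u_def q_def mult.assoc)
  have ki: "invertible k"
    using pq by (simp add: k_def diag_inverse)
  have w1: "w \<noteq> 1"
  proof
    assume "w = 1"
    then have "invertible (mat2 t u t u)"
      using kM invertible_mult[OF ki Mi] by simp
    from invertible_apply_nonzero[OF this, of "inverse t" "- inverse u"] tu show False
      by simp
  qed
  define T where "T = mat2 t 0 0 u"
  have Ti: "invertible T"
    using tu by (simp add: T_def diag_inverse)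
  have kM_frame: "k ** M = frame w ** T"
    by (simp add: kM frame_def T_def)
  have "(k ** g) ** A ** matrix_inv (k ** g) = k ** D ** matrix_inv k"
    using matrix_conj_conj[OF ki gi, of A] by (simp add: gA D_def)
  also have "\<dots> = loxodromic_diag r \<theta> \<phi> (p * I * inverse p) (q * J * inverse q)"
    unfolding k_def D_def using pq by (rule diag_conj_loxodromic_diag)
  finally have A_form: "(k ** g) ** A ** matrix_inv (k ** g)
      = loxodromic_diag r \<theta> \<phi> (p * I * inverse p) (q * J * inverse q)" .
  have "(k ** g) ** B ** matrix_inv (k ** g) = k ** (M ** E ** matrix_inv M) ** matrix_inv k"
    using matrix_conj_conj[OF ki gi, of B] matrix_conj_change_frame[OF gi hi, of B]
    by (simp add: M_def E_def hB)
  also have "\<dots> = frame w ** (T ** E ** matrix_inv T) ** matrix_inv (frame w)"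
    using matrix_conj_conj[OF ki Mi] matrix_conj_conj[OF invertible_frame[OF w1] Ti]
    by (simp add: kM_frame)
  also have "T ** E ** matrix_inv T = loxodromic_diag s \<theta>' \<phi>' (t * K * inverse t) (u * L * inverse u)"
    unfolding T_def E_def using tu by (rule diag_conj_loxodromic_diag)
  finally have B_form: "(k ** g) ** B ** matrix_inv (k ** g)
      = B_normal s \<theta>' \<phi>' w (t * K * inverse t) (u * L * inverse u)"
    by (simp add: B_normal_frame[OF w1])
  have "k ** g \<in> SL2H"
    unfolding k_def using g det by (rule diag_mult_SL2H)
  then have "simultaneously_conjugate A B
      (loxodromic_diag r \<theta> \<phi> (p * I * inverse p) (q * J * inverse q))
      (B_normal s \<theta>' \<phi>' w (t * K * inverse t) (u * L * inverse u))"
    unfolding simultaneously_conjugate_def using A_form B_form by metis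
  then have "normal_form_of A B r \<theta> \<phi> s \<theta>' \<phi>' w (p * I * inverse p) (q * J * inverse q)
      (t * K * inverse t) (u * L * inverse u)"
    unfolding normal_form_of_def
    using r s \<theta> \<theta>' w_half w0 w1 conjugate_imag_units pq tu I K by auto
  then show ?thesis by blast
qed

section \<open>Uniqueness\<close>

lemma matrix_conj_intertwiner:
  fixes g h A :: "quat^2^2"
  assumes "invertible g" "invertible h"
  shows "(h ** matrix_inv g) ** (g ** A ** matrix_inv g)
    = (h ** A ** matrix_inv h) ** (h ** matrix_inv g)"
proof -
  have "(h ** matrix_inv g) ** (g ** A ** matrix_inv g) = h ** (matrix_inv g ** g) ** A ** matrix_inv g"
    by (simp only: matrix_mul_assoc)
  also have "\<dots> = h ** A ** (matrix_inv h ** h) ** matrix_inv g"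
    using assms by (simp add: matrix_inv_left_right)
  finally show ?thesis
    by (simp only: matrix_mul_assoc)
qed

lemma loxodromic_diag_intertwiner:
  assumes "mat2 a b c d ** loxodromic_diag r1 \<theta>1 \<phi>1 I1 J1
      = loxodromic_diag r2 \<theta>2 \<phi>2 I2 J2 ** mat2 a b c d"
    and "1 < r1" "1 < r2" "{I1, J1, I2, J2} \<subseteq> imag_units"
  shows "b = 0" "c = 0"
    "a * (of_real r1 * qcis I1 \<theta>1) = of_real r2 * qcis I2 \<theta>2 * a"
    "d * (of_real (inverse r1) * qcis J1 \<phi>1) = of_real (inverse r2) * qcis J2 \<phi>2 * d"
proof -
  have units: "I1 \<in> imag_units" "J1 \<in> imag_units" "I2 \<in> imag_units" "J2 \<in> imag_units"
    using assms(4) by simp_all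
  note n1 = norm_loxodromic_diag(2,1)[OF assms(2) units(1,2)]
    and n2 = norm_loxodromic_diag(2,1)[OF assms(3) units(3,4)]
  note i = diag_intertwiner[OF assms(1)[unfolded loxodromic_diag_def] n1 n2]
  show "b = 0" "c = 0"
    "a * (of_real r1 * qcis I1 \<theta>1) = of_real r2 * qcis I2 \<theta>2 * a"
    "d * (of_real (inverse r1) * qcis J1 \<phi>1) = of_real (inverse r2) * qcis J2 \<phi>2 * d"
    by (rule i)+
qed

lemma polar_similar_unique:
  assumes "a \<noteq> 0" "a * (of_real r1 * qcis I1 \<theta>1) = of_real r2 * qcis I2 \<theta>2 * a"
    and "0 < r1" "0 < r2" "I1 \<in> imag_units" "I2 \<in> imag_units"
    and "\<theta>1 \<in> {0<..<pi}" "\<theta>2 \<in> {0<..<pi}"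
  shows "r1 = r2 \<and> \<theta>1 = \<theta>2 \<and> I2 = a * I1 * inverse a"
proof -
  have "of_real r2 * qcis I2 \<theta>2 = a * (of_real r1 * qcis I1 \<theta>1) * inverse a"
    using assms(1) by (simp add: assms(2) mult.assoc)
  then have "of_real r2 * qcis I2 \<theta>2 = of_real r1 * qcis (a * I1 * inverse a) \<theta>1"
    by (simp add: conjugate_polar[OF assms(1)])
  from polar_unique[OF this] show ?thesis
    using assms conjugate_imag_units by simp
qed

text \<open>The matrix \<open>M\<close> relating two normal forms of the same pair intertwines the two diagonal
  matrices, and, read in the frames \<open>(1, w)\<close>, also the two matrices conjugate to \<open>B\<close>.
  So both \<open>M\<close> and \<open>N = (frame w\<^sub>2)\<^sup>-\<^sup>1 M (frame w\<^sub>1)\<close> are diagonal. Comparing entries in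
  \<open>M (frame w\<^sub>1) = (frame w\<^sub>2) N\<close> shows that \<open>M\<close> and \<open>N\<close> are the same scalar matrix \<open>a\<close>, and
  that \<open>a\<close> conjugates every datum of the first form to that of the second.\<close>

lemma normal_form_unique:
  assumes n1: "normal_form_of A B r1 \<theta>1 \<phi>1 s1 \<theta>1' \<phi>1' w1 I1 J1 K1 L1"
    and n2: "normal_form_of A B r2 \<theta>2 \<phi>2 s2 \<theta>2' \<phi>2' w2 I2 J2 K2 L2"
  shows "(r1, \<theta>1, \<phi>1, s1, \<theta>1', \<phi>1', w1) = (r2, \<theta>2, \<phi>2, s2, \<theta>2', \<phi>2', w2) \<and>
    (\<exists>q \<in> centralizer w1 \<inter> sphere 0 1. (I2, J2, K2, L2) =
      (q * I1 * inverse q, q * J1 * inverse q, q * K1 * inverse q, q * L1 * inverse q))"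
proof -
  have rs: "1 < r1" "1 < s1" "1 < r2" "1 < s2"
    and I: "{I1, J1, I2, J2} \<subseteq> imag_units" and K: "{K1, L1, K2, L2} \<subseteq> imag_units"
    and ang1: "{\<theta>1, \<phi>1, \<theta>1', \<phi>1'} \<subseteq> {0<..<pi}" and ang2: "{\<theta>2, \<phi>2, \<theta>2', \<phi>2'} \<subseteq> {0<..<pi}"
    and w: "w1 \<in> closed_upper_half_plane" "w2 \<in> closed_upper_half_plane" "w1 \<noteq> 1" "w2 \<noteq> 1"
    using n1 n2 unfolding normal_form_of_def by auto
  define D1 where "D1 = loxodromic_diag r1 \<theta>1 \<phi>1 I1 J1"
  define D2 where "D2 = loxodromic_diag r2 \<theta>2 \<phi>2 I2 J2"
  define E1 where "E1 = loxodromic_diag s1 \<theta>1' \<phi>1' K1 L1"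
  define E2 where "E2 = loxodromic_diag s2 \<theta>2' \<phi>2' K2 L2"
  define Q1 where "Q1 = frame w1"
  define Q2 where "Q2 = frame w2"
  have Q: "invertible Q1" "invertible Q2"
    unfolding Q1_def Q2_def using w by (simp_all add: invertible_frame)
  obtain g1 where g1: "g1 \<in> SL2H" "D1 = g1 ** A ** matrix_inv g1"
    "Q1 ** E1 ** matrix_inv Q1 = g1 ** B ** matrix_inv g1"
    using n1 w unfolding normal_form_of_def simultaneously_conjugate_def D1_def E1_def Q1_def
    by (auto simp: B_normal_frame)
  obtain g2 where g2: "g2 \<in> SL2H" "D2 = g2 ** A ** matrix_inv g2"
    "Q2 ** E2 ** matrix_inv Q2 = g2 ** B ** matrix_inv g2"
    using n2 w unfolding normal_form_of_def simultaneously_conjugate_def D2_def E2_def Q2_def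
    by (auto simp: B_normal_frame)
  have gi: "invertible g1" "invertible g2"
    using g1 g2 by (simp_all add: SL2H_invertible)
  define M where "M = g2 ** matrix_inv g1"
  define N where "N = matrix_inv Q2 ** M ** Q1"
  have Mi: "invertible M"
    unfolding M_def using gi by (intro invertible_mult invertible_matrix_inv)
  have MD: "M ** D1 = D2 ** M"
    unfolding M_def g1(2) g2(2) by (rule matrix_conj_intertwiner[OF gi])
  have MB: "M ** (Q1 ** E1 ** matrix_inv Q1) = (Q2 ** E2 ** matrix_inv Q2) ** M"
    unfolding M_def g1(3) g2(3) by (rule matrix_conj_intertwiner[OF gi])
  have "N ** E1 = matrix_inv Q2 ** (M ** (Q1 ** E1 ** matrix_inv Q1)) ** Q1"
    using Q by (simp add: N_def matrix_mul_assoc[symmetric] matrix_inv_left_right)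
  also have "\<dots> = (matrix_inv Q2 ** Q2) ** E2 ** matrix_inv Q2 ** M ** Q1"
    unfolding MB by (simp only: matrix_mul_assoc)
  also have "\<dots> = E2 ** N"
    using Q by (simp add: N_def matrix_mul_assoc matrix_inv_left_right)
  finally have NE: "N ** E1 = E2 ** N" .
  obtain a b c d where M: "M = mat2 a b c d" by (rule mat2_cases)
  obtain n n' m' m where N: "N = mat2 n n' m' m" by (rule mat2_cases)
  note M_diag = loxodromic_diag_intertwiner[OF MD[unfolded M D1_def D2_def] rs(1,3) I]
  note N_diag = loxodromic_diag_intertwiner[OF NE[unfolded N E1_def E2_def] rs(2,4) K]
  have "Q2 ** N = (Q2 ** matrix_inv Q2) ** M ** Q1"
    by (simp only: N_def matrix_mul_assoc)
  then have "Q2 ** N = M ** Q1"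
    using Q by (simp add: matrix_inv_left_right)
  then have scalar: "n = a" "m = a" "d = a" and aw: "a * w1 = w2 * a"
    using M_diag(1,2) N_diag(1,2) by (auto simp: M N Q1_def Q2_def frame_def)
  have a: "a \<noteq> 0"
    using Mi M_diag(1,2) M by (metis invertible_diag_nonzero(1))
  have ww: "w1 = w2"
    by (rule closed_upper_half_plane_similar_unique[OF w(1,2) a aw])
  have 1: "r1 = r2 \<and> \<theta>1 = \<theta>2 \<and> I2 = a * I1 * inverse a"
    by (rule polar_similar_unique[OF a M_diag(3)]) (use rs I ang1 ang2 in simp_all)
  have 2: "\<phi>1 = \<phi>2 \<and> J2 = a * J1 * inverse a"
    by (rule conjunct2, rule polar_similar_unique[OF a M_diag(4)[unfolded scalar]])
       (use rs I ang1 ang2 in simp_all)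
  have 3: "s1 = s2 \<and> \<theta>1' = \<theta>2' \<and> K2 = a * K1 * inverse a"
    by (rule polar_similar_unique[OF a N_diag(3)[unfolded scalar]]) (use rs K ang1 ang2 in simp_all)
  have 4: "\<phi>1' = \<phi>2' \<and> L2 = a * L1 * inverse a"
    by (rule conjunct2, rule polar_similar_unique[OF a N_diag(4)[unfolded scalar]])
       (use rs K ang1 ang2 in simp_all)
  define q where "q = of_real (inverse (norm a)) * a"
  have q: "norm q = 1"
    using a by (simp add: q_def norm_mult norm_inverse)
  then have "q \<noteq> 0" by auto
  have conj_q: "q * x * inverse q = a * x * inverse a" for x
    unfolding q_def using a by (intro conjugate_scaled) simp
  have "q * w1 = w1 * q"
    using aw ww by (simp add: q_def of_real_def)
  then have "q \<in> centralizer w1 \<inter> sphere 0 1"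
    using q \<open>q \<noteq> 0\<close> by (simp add: centralizer_def)
  moreover have "(I2, J2, K2, L2) =
      (q * I1 * inverse q, q * J1 * inverse q, q * K1 * inverse q, q * L1 * inverse q)"
    using 1 2 3 4 by (simp add: conj_q)
  ultimately show ?thesis
    using 1 2 3 4 ww by blast
qed

text \<open>A unit quaternion commuting with \<open>w\<close>, viewed as a scalar matrix, commutes with the frame
  \<open>(1, w)\<close>. Conjugation by it therefore preserves the shape of the normal form.\<close>

lemma normal_form_conjugate:
  assumes nf: "normal_form_of A B r \<theta> \<phi> s \<theta>' \<phi>' w I J K L"
    and q: "q \<in> centralizer w \<inter> sphere 0 1"
  shows "normal_form_of A B r \<theta> \<phi> s \<theta>' \<phi>' w
    (q * I * inverse q) (q * J * inverse q) (q * K * inverse q) (q * L * inverse q)"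
proof -
  have q0: "q \<noteq> 0" and qw: "q * w = w * q" and nq: "norm q = 1"
    using q by (auto simp: centralizer_def)
  have w1: "w \<noteq> 1"
    using nf by (simp add: normal_form_of_def)
  define E where "E = loxodromic_diag s \<theta>' \<phi>' K L"
  obtain g where g: "g \<in> SL2H" "loxodromic_diag r \<theta> \<phi> I J = g ** A ** matrix_inv g"
    "frame w ** E ** matrix_inv (frame w) = g ** B ** matrix_inv g"
    using nf w1 unfolding normal_form_of_def simultaneously_conjugate_def E_def
    by (auto simp: B_normal_frame)
  have gi: "invertible g" using g by (simp add: SL2H_invertible)
  define k where "k = mat2 q 0 0 q"
  have ki: "invertible k" using q0 by (simp add: k_def diag_inverse)
  have comm: "k ** frame w = frame w ** k"
    using qw by (simp add: k_def frame_def)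
  have "(k ** g) ** A ** matrix_inv (k ** g) = k ** loxodromic_diag r \<theta> \<phi> I J ** matrix_inv k"
    using matrix_conj_conj[OF ki gi, of A] g(2) by simp
  also have "\<dots> = loxodromic_diag r \<theta> \<phi> (q * I * inverse q) (q * J * inverse q)"
    unfolding k_def using q0 q0 by (rule diag_conj_loxodromic_diag)
  finally have A: "(k ** g) ** A ** matrix_inv (k ** g)
    = loxodromic_diag r \<theta> \<phi> (q * I * inverse q) (q * J * inverse q)" .
  have "(k ** g) ** B ** matrix_inv (k ** g)
      = k ** (frame w ** E ** matrix_inv (frame w)) ** matrix_inv k"
    using matrix_conj_conj[OF ki gi, of B] g(3) by simp
  also have "\<dots> = frame w ** (k ** E ** matrix_inv k) ** matrix_inv (frame w)"
    using matrix_conj_conj[OF ki invertible_frame[OF w1]] matrix_conj_conj[OF invertible_frame[OF w1] ki]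
    by (simp add: comm)
  also have "k ** E ** matrix_inv k = loxodromic_diag s \<theta>' \<phi>' (q * K * inverse q) (q * L * inverse q)"
    unfolding k_def E_def using q0 q0 by (rule diag_conj_loxodromic_diag)
  finally have B: "(k ** g) ** B ** matrix_inv (k ** g)
      = B_normal s \<theta>' \<phi>' w (q * K * inverse q) (q * L * inverse q)"
    by (simp add: B_normal_frame[OF w1])
  have "k ** g \<in> SL2H"
    unfolding k_def using g nq by (intro diag_mult_SL2H) simp_all
  then have "simultaneously_conjugate A B
      (loxodromic_diag r \<theta> \<phi> (q * I * inverse q) (q * J * inverse q))
      (B_normal s \<theta>' \<phi>' w (q * K * inverse q) (q * L * inverse q))"
    unfolding simultaneously_conjugate_def using A B by metis
  then show ?thesis
    using nf conjugate_imag_units[OF q0] by (simp add: normal_form_of_def)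
qed

section \<open>The stabiliser circle\<close>

lemma group_unit_centralizer: "group (unit_centralizer w)"
proof (rule groupI)
  fix x assume x: "x \<in> carrier (unit_centralizer w)"
  then have "x \<noteq> 0" "x * w = w * x" "norm x = 1"
    by (auto simp: unit_centralizer_def centralizer_def)
  have "inverse x * w = inverse x * (w * x) * inverse x"
    using \<open>x \<noteq> 0\<close> by (simp add: mult.assoc)
  also have "\<dots> = inverse x * x * w * inverse x"
    by (simp only: \<open>x * w = w * x\<close>[symmetric] mult.assoc)
  also have "\<dots> = w * inverse x"
    using \<open>x \<noteq> 0\<close> by simp
  finally have "inverse x \<in> carrier (unit_centralizer w)"
    using \<open>x \<noteq> 0\<close> \<open>norm x = 1\<close> by (simp add: unit_centralizer_def centralizer_def norm_inverse)
  then show "\<exists>y\<in>carrier (unit_centralizer w). y \<otimes>\<^bsub>unit_centralizer w\<^esub> x = \<one>\<^bsub>unit_centralizer w\<^esub>"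
    using \<open>x \<noteq> 0\<close> by (intro bexI[of _ "inverse x"]) (simp_all add: unit_centralizer_def)
next
  fix x y assume "x \<in> carrier (unit_centralizer w)" "y \<in> carrier (unit_centralizer w)"
  then show "x \<otimes>\<^bsub>unit_centralizer w\<^esub> y \<in> carrier (unit_centralizer w)"
    by (auto simp: unit_centralizer_def centralizer_def norm_mult) (metis mult.assoc)
qed (auto simp: unit_centralizer_def centralizer_def mult.assoc)

text \<open>Commuting with a nonreal element of the plane \<open>\<real> + \<real> i\<close> means lying in that plane, whose
  unit elements are the complex unit circle.\<close>

lemma centralizer_nonreal:
  assumes "w \<in> closed_upper_half_plane" "w \<notin> \<real>"
  shows "centralizer w = {q. q \<noteq> 0 \<and> qJ q = 0 \<and> qK q = 0}"
proof -
  have w: "qJ w = 0" "qK w = 0"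
    using assms(1) by (simp_all add: closed_upper_half_plane_iff)
  have "qI w \<noteq> 0"
  proof
    assume "qI w = 0"
    then have "w = of_real (qRe w)"
      using w by (simp add: quat_eq_iff)
    then show False
      using assms(2) by (metis Reals_of_real)
  qed
  then show ?thesis
    by (auto simp: centralizer_def quat_eq_iff w)
qed

lemma unit_centralizer_circle:
  assumes "w \<in> closed_upper_half_plane" "w \<notin> \<real>"
  shows "\<exists>h \<in> iso (unit_centralizer w) circle_group.
    homeomorphic_map (top_of_set (carrier (unit_centralizer w)))
      (top_of_set (carrier circle_group)) h"
proof -
  define C where "C = carrier (unit_centralizer w)"
  define h where "h q = Complex (qRe q) (qI q)" for q
  define k where "k z = Re z *\<^sub>R 1 + Im z *\<^sub>R quat_i" for z
  have C: "C = {q. norm q = 1 \<and> qJ q = 0 \<and> qK q = 0}"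
  proof -
    have "C = centralizer w \<inter> sphere 0 1"
      by (simp add: C_def unit_centralizer_def)
    also have "\<dots> = {q. q \<noteq> 0 \<and> qJ q = 0 \<and> qK q = 0 \<and> norm q = 1}"
      unfolding centralizer_nonreal[OF assms] by (simp add: set_eq_iff)
    finally show ?thesis
      using norm_zero by fastforce
  qed
  have sel: "qRe (k z) = Re z" "qI (k z) = Im z" "qJ (k z) = 0" "qK (k z) = 0" for z
    by (simp_all add: k_def quat_i_def)
  have hC: "h q \<in> sphere 0 1" if "q \<in> C" for q
    using that by (auto simp: C h_def cmod_def norm_quat_def)
  have kC: "k z \<in> C" if "z \<in> sphere 0 1" for z
    using that by (simp add: C sel cmod_def norm_quat_def)
  have hk: "h (k z) = z" for z
    by (simp add: h_def sel)
  have kh: "k (h q) = q" if "q \<in> C" for q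
    using that by (simp add: quat_eq_iff sel h_def C)
  have h_eq: "h q = of_real (q \<bullet> 1) + \<i> * of_real (q \<bullet> quat_i)" for q
    by (simp add: h_def complex_eq_iff inner_quat_def quat_i_def)
  have "continuous_on C h"
    unfolding h_eq by (intro continuous_intros)
  moreover have "continuous_on (sphere 0 1) k"
    unfolding k_def by (intro continuous_intros)
  ultimately have "homeomorphic_maps (top_of_set C) (top_of_set (sphere 0 1)) h k"
    using hC kC hk kh
    by (auto simp: homeomorphic_maps_def continuous_map_in_subtopology)
  then have homeo: "homeomorphic_map (top_of_set C) (top_of_set (carrier circle_group)) h"
    unfolding homeomorphic_map_maps circle_group_def by auto
  have "bij_betw h C (sphere 0 1)"
    using hC kC hk kh by (intro bij_betw_byWitness[where f' = k]) auto
  moreover have "h (x * y) = h x * h y" if "x \<in> C" "y \<in> C" for x y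
    using that by (simp add: C h_def complex_eq_iff)
  moreover have "monoid.mult (unit_centralizer w) = (*)" "monoid.mult circle_group = (*)"
    by (simp_all add: unit_centralizer_def circle_group_def)
  moreover have "carrier circle_group = sphere 0 1"
    by (simp add: circle_group_def)
  ultimately have "h \<in> iso (unit_centralizer w) circle_group"
    using hC unfolding iso_def hom_def C_def[symmetric] by simp
  with homeo show ?thesis
    unfolding C_def by blast
qed

section \<open>Classification\<close>

theorem theorem1p2:
  fixes A B :: "quat^2^2"
  assumes "regular_loxodromic_pair A B"
  shows
    "(\<exists>r \<theta> \<phi> s \<theta>' \<phi>' w I J K L. normal_form_of A B r \<theta> \<phi> s \<theta>' \<phi>' w I J K L) \<and>
     (\<forall>r1 \<theta>1 \<phi>1 s1 \<theta>1' \<phi>1' w1 I1 J1 K1 L1 r2 \<theta>2 \<phi>2 s2 \<theta>2' \<phi>2' w2 I2 J2 K2 L2.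
        normal_form_of A B r1 \<theta>1 \<phi>1 s1 \<theta>1' \<phi>1' w1 I1 J1 K1 L1 \<and>
        normal_form_of A B r2 \<theta>2 \<phi>2 s2 \<theta>2' \<phi>2' w2 I2 J2 K2 L2 \<longrightarrow>
          (r1, \<theta>1, \<phi>1, s1, \<theta>1', \<phi>1', w1) = (r2, \<theta>2, \<phi>2, s2, \<theta>2', \<phi>2', w2)) \<and>
     (\<forall>r \<theta> \<phi> s \<theta>' \<phi>' w I J K L. normal_form_of A B r \<theta> \<phi> s \<theta>' \<phi>' w I J K L \<longrightarrow>
        (\<forall>I' J' K' L'.
           normal_form_of A B r \<theta> \<phi> s \<theta>' \<phi>' w I' J' K' L' \<longleftrightarrow>
           (\<exists>q \<in> centralizer w \<inter> sphere 0 1.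
              (I', J', K', L') =
              (q * I * inverse q, q * J * inverse q, q * K * inverse q, q * L * inverse q))) \<and>
        group (unit_centralizer w) \<and>
        (w \<notin> \<real> \<longrightarrow>
           (\<exists>h \<in> iso (unit_centralizer w) circle_group.
              homeomorphic_map (top_of_set (carrier (unit_centralizer w)))
                (top_of_set (carrier circle_group)) h)) \<and>
        cross_ratio_pair (loxodromic_diag r \<theta> \<phi> I J) (B_normal s \<theta>' \<phi>' w K L) = w)"
proof (intro conjI allI impI)
  show "\<exists>r \<theta> \<phi> s \<theta>' \<phi>' w I J K L. normal_form_of A B r \<theta> \<phi> s \<theta>' \<phi>' w I J K L"
    using assms by (rule regular_loxodromic_pair_normal_form)
next
  fix r1 \<theta>1 \<phi>1 s1 \<theta>1' \<phi>1' w1 I1 J1 K1 L1 r2 \<theta>2 \<phi>2 s2 \<theta>2' \<phi>2' w2 I2 J2 K2 L2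
  assume "normal_form_of A B r1 \<theta>1 \<phi>1 s1 \<theta>1' \<phi>1' w1 I1 J1 K1 L1 \<and>
    normal_form_of A B r2 \<theta>2 \<phi>2 s2 \<theta>2' \<phi>2' w2 I2 J2 K2 L2"
  then show "(r1, \<theta>1, \<phi>1, s1, \<theta>1', \<phi>1', w1) = (r2, \<theta>2, \<phi>2, s2, \<theta>2', \<phi>2', w2)"
    by (intro conjunct1[OF normal_form_unique]; elim conjE)
next
  fix r \<theta> \<phi> s \<theta>' \<phi>' w I J K L
  assume nf: "normal_form_of A B r \<theta> \<phi> s \<theta>' \<phi>' w I J K L"
  fix I' J' K' L'
  show "normal_form_of A B r \<theta> \<phi> s \<theta>' \<phi>' w I' J' K' L' \<longleftrightarrow>
      (\<exists>q \<in> centralizer w \<inter> sphere 0 1. (I', J', K', L') =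
        (q * I * inverse q, q * J * inverse q, q * K * inverse q, q * L * inverse q))"
  proof
    assume "normal_form_of A B r \<theta> \<phi> s \<theta>' \<phi>' w I' J' K' L'"
    with nf show "\<exists>q \<in> centralizer w \<inter> sphere 0 1. (I', J', K', L') =
        (q * I * inverse q, q * J * inverse q, q * K * inverse q, q * L * inverse q)"
      by (rule conjunct2[OF normal_form_unique])
  next
    assume "\<exists>q \<in> centralizer w \<inter> sphere 0 1. (I', J', K', L') =
        (q * I * inverse q, q * J * inverse q, q * K * inverse q, q * L * inverse q)"
    then show "normal_form_of A B r \<theta> \<phi> s \<theta>' \<phi>' w I' J' K' L'"
      using normal_form_conjugate[OF nf] by auto
  qed
next
  fix r \<theta> \<phi> s \<theta>' \<phi>' w I J K L
  assume nf: "normal_form_of A B r \<theta> \<phi> s \<theta>' \<phi>' w I J K L"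
  show "group (unit_centralizer w)"
    by (rule group_unit_centralizer)
  show "cross_ratio_pair (loxodromic_diag r \<theta> \<phi> I J) (B_normal s \<theta>' \<phi>' w K L) = w"
    using nf unfolding normal_form_of_def by (intro cross_ratio_normal_form) auto
  assume "w \<notin> \<real>"
  with nf show "\<exists>h \<in> iso (unit_centralizer w) circle_group.
      homeomorphic_map (top_of_set (carrier (unit_centralizer w)))
        (top_of_set (carrier circle_group)) h"
    unfolding normal_form_of_def by (intro unit_centralizer_circle) auto
qed

end
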